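(* Let $K$ be an inversive difference field with basic set $\sigma=\{\alpha_1,\alpha_2\}$ whose elements are functions $f(z,t)$, with $\alpha_1:f(z,t)\mapsto f(z+1,t)$ and $\alpha_2:f(z,t)\mapsto f(z,t+1)$. Let $K\{y_1,\dots,y_{2N}\}^*$ be the ring of $\sigma^*$-polynomials in $2N$ $\sigma^*$-indeterminates over $K$. Consider difference schemes for the system of mass balance equations of chromatography for $N$ components in a column slice, $$\frac{\partial C_i}{\partial t}+F\frac{\partial C_{s,i}}{\partial t}+u\frac{\partial C_i}{\partial z}=D_{L,i}\frac{\partial^2C_i}{\partial z^2}\qquad(1\le i\le N),$$ where $C_i$ and $C_{s,i}$ are the concentrations of the individual components in the mobile phase and in the stationary phase, $u$ and $D_{L,i}$ are constants along the column, the coefficients $F,u,D_{L,i}$ lie in $K$, and $y_{2i-1}$ and $y_{2i}$ stand for $C_i$ and $C_{s,i}$. (1) (Forward scheme.) The forward difference scheme leads to the system $$D_{L,i}\alpha_1^2y_{2i-1}+a_i\alpha_1y_{2i-1}-F\alpha_2y_{2i}-\alpha_2y_{2i-1}+Fy_{2i}+b_iy_{2i-1}=0\qquad(1\le i\le N),$$ where $a_i=-u-2D_{L,i}$ and $b_i=-D_{L,i}-u-1$. The $\sigma^*$-dimension polynomial that expresses the strength of the forward difference scheme for the mass balance system is $$\psi_{Forw}(t)=2t^2+7t+1.$$ (2) (Symmetric scheme.) The symmetric difference scheme leads to the system, taken in the form $$(u-D_{L,i})\alpha_1y_{2i-1}-(u+D_{L,i})\alpha_1^{-1}y_{2i-1}+F\alpha_2y_{2i}-F\alpha_2^{-1}y_{2i}+2D_{L,i}y_{2i-1}=0\qquad(1\le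 i\le N).$$ The strength of the symmetric difference scheme for the mass balance system is represented by the $\sigma^*$-dimension polynomial $$\psi_{Symm}(t)=2t^2+6t+1.$$ Hence, from the point of view of Einstein's strength, the symmetric scheme should be preferred to the forward one, although the difference between the two is quite small.
   Context: All fields have characteristic zero. An inversive difference field with basic set $\sigma=\{\alpha_1,\alpha_2\}$ is a field with commuting automorphisms $\alpha_1,\alpha_2$. $\Gamma$ is the free commutative group of all $\gamma=\alpha_1^{i_1}\alpha_2^{i_2}$ ($i_1,i_2\in\mathbb Z$), $\mathrm{ord}\,\gamma=|i_1|+|i_2|$, and $\Gamma(r)=\{\gamma\in\Gamma:\mathrm{ord}\,\gamma\le r\}$. $K\{y_1,\dots,y_n\}^*$ is the polynomial ring over $K$ in the algebraically independent indeterminates $\gamma y_i$ ($\gamma\in\Gamma$, $1\le i\le n$), on which $\Gamma$ acts by $\gamma'(\gamma y_i)=(\gamma'\gamma)y_i$ and by the given action on coefficients. A system of equations $A_1=0,\dots,A_q=0$ with $A_i\in K\{y_1,\dots,y_n\}^*$ is prime if the ideal $P=[A_1,\dots,A_q]^*$ generated by all $\gamma A_i$ ($\gamma\in\Gamma$, $1\le i\le q$) is prime. Let then $L$ be the quotient field of $K\{y_1,\dots,y_n\}^*/P$ and $\eta_i$ the image of $y_i$. The $\sigma^*$-dimension polynomial of the system is the unique polynomial $\psi(t)\in\mathbb Q[t]$ such that $\psi(r)=\mathrm{tr.deg}_K K(\{\gamma\eta_i:\gamma\in\Gamma(r),\,1\le i\le n\})$ for all sufficiently large integers $r$ (it exists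 for every prime system). Saying that a system has a given $\sigma^*$-dimension polynomial includes the assertion that the system is prime. This polynomial expresses Einstein's strength of the system; a smaller polynomial (for all sufficiently large integer arguments) means higher strength.
   Formalization: The printed polynomials are proved for each single component; the full system of N components has N times them (the printed claim fails for N≥2). F and all D_{L,i} are assumed nonzero (for D_{L,i}=0 the forward claim fails). The two systems are taken as printed, not derived. *)

theory Defs
  imports
    "HOL-Algebra.QuotRing"
    "HOL-Algebra.Generated_Fields"
    "HOL-Algebra.Finite_Extensions"
    "HOL-Library.Poly_Mapping"
    "HOL-Library.Product_Plus"
    "HOL-Computational_Algebra.Polynomial"
begin

section \<open>Inversive difference fields with two translations\<close>

definition field_automorphism :: "('k::field \<Rightarrow> 'k) \<Rightarrow> bool" where
  "field_automorphism f \<longleftrightarrow> bij f \<and> f 1 = 1 \<and>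
     (\<forall>x y. f (x + y) = f x + f y) \<and> (\<forall>x y. f (x * y) = f x * f y)"

text \<open>Every such field is a field of functions of two arguments on which the two
  automorphisms are the unit shifts: send \<open>c\<close> to the function
  \<open>(z, t) \<mapsto> \<alpha>1^z (\<alpha>2^t c)\<close> on pairs of integers, with pointwise addition and
  multiplication. Conversely, a field of functions of \<open>(z, t)\<close>, in whatever sense
  (rational, meromorphic, ...), that is mapped onto itself by both shifts is such a field.\<close>

definition inversive_difference_field :: "('k::field_char_0 \<Rightarrow> 'k) \<Rightarrow> ('k \<Rightarrow> 'k) \<Rightarrow> bool" where
  "inversive_difference_field \<alpha>1 \<alpha>2 \<longleftrightarrow>
     field_automorphism \<alpha>1 \<and> field_automorphism \<alpha>2 \<and> \<alpha>1 \<circ> \<alpha>2 = \<alpha>2 \<circ> \<alpha>1"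

text \<open>The free commutative group on two generators, written additively: \<open>(i, j)\<close> is
  \<open>\<alpha>1^i \<alpha>2^j\<close>.\<close>

type_synonym gam = "int \<times> int"

definition ord_gam :: "gam \<Rightarrow> int" where
  "ord_gam \<gamma> = \<bar>fst \<gamma>\<bar> + \<bar>snd \<gamma>\<bar>"

definition Gam :: "int \<Rightarrow> gam set" where
  "Gam r = {\<gamma>. ord_gam \<gamma> \<le> r}"

definition int_iter :: "('a \<Rightarrow> 'a) \<Rightarrow> int \<Rightarrow> 'a \<Rightarrow> 'a" where
  "int_iter f n = (if n \<ge> 0 then f ^^ nat n else inv_into UNIV f ^^ nat (- n))"

definition gam_coeff :: "('k \<Rightarrow> 'k) \<Rightarrow> ('k \<Rightarrow> 'k) \<Rightarrow> gam \<Rightarrow> 'k \<Rightarrow> 'k" where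
  "gam_coeff \<alpha>1 \<alpha>2 \<gamma> = int_iter \<alpha>1 (fst \<gamma>) \<circ> int_iter \<alpha>2 (snd \<gamma>)"


section \<open>Inversive difference polynomials\<close>

text \<open>The variable \<open>(i, \<gamma>)\<close> stands for \<open>\<gamma> y\<^sub>i\<close>.\<close>

type_synonym svar = "nat \<times> gam"
type_synonym 'k spoly = "(svar \<Rightarrow>\<^sub>0 nat) \<Rightarrow>\<^sub>0 'k"

definition cst :: "'k::zero \<Rightarrow> 'k spoly" where
  "cst c = Poly_Mapping.single 0 c"

definition Y :: "gam \<Rightarrow> nat \<Rightarrow> 'k::{zero,one} spoly" where
  "Y \<gamma> i = Poly_Mapping.single (Poly_Mapping.single (i, \<gamma>) 1) 1"

definition gam_monom :: "gam \<Rightarrow> (svar \<Rightarrow>\<^sub>0 nat) \<Rightarrow> (svar \<Rightarrow>\<^sub>0 nat)" where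
  "gam_monom \<gamma> m = (\<Sum>v\<in>Poly_Mapping.keys m.
     Poly_Mapping.single (fst v, \<gamma> + snd v) (Poly_Mapping.lookup m v))"

definition gam_act :: "('k::field \<Rightarrow> 'k) \<Rightarrow> ('k \<Rightarrow> 'k) \<Rightarrow> gam \<Rightarrow> 'k spoly \<Rightarrow> 'k spoly" where
  "gam_act \<alpha>1 \<alpha>2 \<gamma> p = (\<Sum>m\<in>Poly_Mapping.keys p.
     Poly_Mapping.single (gam_monom \<gamma> m) (gam_coeff \<alpha>1 \<alpha>2 \<gamma> (Poly_Mapping.lookup p m)))"

text \<open>The ring of inversive difference polynomials in the indeterminates \<open>y\<^sub>i\<close>, \<open>i \<in> I\<close>.\<close>

definition spoly_ring :: "nat set \<Rightarrow> 'k::field spoly ring" where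
  "spoly_ring I =
     \<lparr>carrier = {p. \<forall>m\<in>Poly_Mapping.keys p. \<forall>v\<in>Poly_Mapping.keys m. fst v \<in> I},
      monoid.mult = (*), one = 1, zero = 0, add = (+)\<rparr>"

definition sigma_ideal ::
  "('k::field \<Rightarrow> 'k) \<Rightarrow> ('k \<Rightarrow> 'k) \<Rightarrow> nat set \<Rightarrow> 'k spoly set \<Rightarrow> 'k spoly set" where
  "sigma_ideal \<alpha>1 \<alpha>2 I S = genideal (spoly_ring I) {gam_act \<alpha>1 \<alpha>2 \<gamma> A | \<gamma> A. A \<in> S}"

definition prime_system ::
  "('k::field \<Rightarrow> 'k) \<Rightarrow> ('k \<Rightarrow> 'k) \<Rightarrow> nat set \<Rightarrow> 'k spoly set \<Rightarrow> bool" where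
  "prime_system \<alpha>1 \<alpha>2 I S \<longleftrightarrow> primeideal (sigma_ideal \<alpha>1 \<alpha>2 I S) (spoly_ring I)"


section \<open>Quotient field of a domain\<close>

definition frac_rel :: "('a, 'b) ring_scheme \<Rightarrow> (('a \<times> 'a) \<times> ('a \<times> 'a)) set" where
  "frac_rel R = {((a, b), (c, d)).
     a \<in> carrier R \<and> b \<in> carrier R - {\<zero>\<^bsub>R\<^esub>} \<and> c \<in> carrier R \<and> d \<in> carrier R - {\<zero>\<^bsub>R\<^esub>} \<and>
     a \<otimes>\<^bsub>R\<^esub> d = c \<otimes>\<^bsub>R\<^esub> b}"

definition fraction :: "('a, 'b) ring_scheme \<Rightarrow> 'a \<Rightarrow> 'a \<Rightarrow> ('a \<times> 'a) set" where
  "fraction R a b = frac_rel R `` {(a, b)}"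

definition quot_field :: "('a, 'b) ring_scheme \<Rightarrow> ('a \<times> 'a) set ring" where
  "quot_field R =
     \<lparr>carrier = (carrier R \<times> (carrier R - {\<zero>\<^bsub>R\<^esub>})) // frac_rel R,
      monoid.mult = (\<lambda>U V. \<Union>(a, b)\<in>U. \<Union>(c, d)\<in>V. fraction R (a \<otimes>\<^bsub>R\<^esub> c) (b \<otimes>\<^bsub>R\<^esub> d)),
      one = fraction R \<one>\<^bsub>R\<^esub> \<one>\<^bsub>R\<^esub>,
      zero = fraction R \<zero>\<^bsub>R\<^esub> \<one>\<^bsub>R\<^esub>,
      add = (\<lambda>U V. \<Union>(a, b)\<in>U. \<Union>(c, d)\<in>V.
               fraction R ((a \<otimes>\<^bsub>R\<^esub> d) \<oplus>\<^bsub>R\<^esub> (c \<otimes>\<^bsub>R\<^esub> b)) (b \<otimes>\<^bsub>R\<^esub> d))\<rparr>"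


section \<open>Transcendence degree\<close>

text \<open>Here \<open>L\<close> is a field and \<open>\<iota>\<close> embeds the ground field into it. The
  variables of the polynomials are the elements of \<open>L\<close> themselves, each
  evaluated at itself.\<close>

definition mpoly_value ::
  "('l, 'm) ring_scheme \<Rightarrow> ('k::zero \<Rightarrow> 'l) \<Rightarrow> (('l \<Rightarrow>\<^sub>0 nat) \<Rightarrow>\<^sub>0 'k) \<Rightarrow> 'l" where
  "mpoly_value L \<iota> p = (\<Oplus>\<^bsub>L\<^esub>m\<in>Poly_Mapping.keys p.
     \<iota> (Poly_Mapping.lookup p m) \<otimes>\<^bsub>L\<^esub>
       (\<Otimes>\<^bsub>L\<^esub>x\<in>Poly_Mapping.keys m. x [^]\<^bsub>L\<^esub> Poly_Mapping.lookup m x))"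

definition alg_independent ::
  "('l, 'm) ring_scheme \<Rightarrow> ('k::zero \<Rightarrow> 'l) \<Rightarrow> 'l set \<Rightarrow> bool" where
  "alg_independent L \<iota> B \<longleftrightarrow> B \<subseteq> carrier L \<and>
     (\<forall>p. (\<forall>m\<in>Poly_Mapping.keys p. Poly_Mapping.keys m \<subseteq> B) \<longrightarrow>
          mpoly_value L \<iota> p = \<zero>\<^bsub>L\<^esub> \<longrightarrow> p = 0)"

definition transcendence_basis ::
  "('l, 'm) ring_scheme \<Rightarrow> ('k::zero \<Rightarrow> 'l) \<Rightarrow> 'l set \<Rightarrow> 'l set \<Rightarrow> bool" where
  "transcendence_basis L \<iota> E B \<longleftrightarrow> B \<subseteq> E \<and> alg_independent L \<iota> B \<and>
     (\<forall>x\<in>E. (ring.algebraic L over generate_field L (range \<iota> \<union> B)) x)"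

text \<open>Transcendence degree as a relation: the subfield \<open>E\<close> has a transcendence basis
  with \<open>d\<close> elements. All transcendence bases have the same cardinality, so \<open>d\<close>
  is determined by \<open>E\<close>.\<close>

definition has_trdeg ::
  "('l, 'm) ring_scheme \<Rightarrow> ('k::zero \<Rightarrow> 'l) \<Rightarrow> 'l set \<Rightarrow> nat \<Rightarrow> bool" where
  "has_trdeg L \<iota> E d \<longleftrightarrow> (\<exists>B. transcendence_basis L \<iota> E B \<and> finite B \<and> card B = d)"


section \<open>Difference dimension polynomials and Einstein's strength\<close>

definition sys_ring ::
  "('k::field \<Rightarrow> 'k) \<Rightarrow> ('k \<Rightarrow> 'k) \<Rightarrow> nat set \<Rightarrow> 'k spoly set \<Rightarrow> 'k spoly set ring" where
  "sys_ring \<alpha>1 \<alpha>2 I S = spoly_ring I Quot sigma_ideal \<alpha>1 \<alpha>2 I S"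

definition sys_field where
  "sys_field \<alpha>1 \<alpha>2 I S = quot_field (sys_ring \<alpha>1 \<alpha>2 I S)"

definition sys_image where
  "sys_image \<alpha>1 \<alpha>2 I S f =
     fraction (sys_ring \<alpha>1 \<alpha>2 I S)
       (sigma_ideal \<alpha>1 \<alpha>2 I S +>\<^bsub>spoly_ring I\<^esub> f) \<one>\<^bsub>sys_ring \<alpha>1 \<alpha>2 I S\<^esub>"

definition sigma_dim_poly ::
  "('k::field \<Rightarrow> 'k) \<Rightarrow> ('k \<Rightarrow> 'k) \<Rightarrow> nat set \<Rightarrow> 'k spoly set \<Rightarrow> rat poly \<Rightarrow> bool" where
  "sigma_dim_poly \<alpha>1 \<alpha>2 I S \<psi> \<longleftrightarrow>
     prime_system \<alpha>1 \<alpha>2 I S \<and>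
     (let L = sys_field \<alpha>1 \<alpha>2 I S;
          \<iota> = (\<lambda>c. sys_image \<alpha>1 \<alpha>2 I S (cst c));
          \<eta> = (\<lambda>\<gamma> i. sys_image \<alpha>1 \<alpha>2 I S (Y \<gamma> i))
      in \<forall>\<^sub>F r in at_top. \<exists>d.
           has_trdeg L \<iota> (generate_field L (range \<iota> \<union> {\<eta> \<gamma> i | \<gamma> i. \<gamma> \<in> Gam r \<and> i \<in> I})) d \<and>
           poly \<psi> (of_int r) = of_nat d)"

text \<open>The first system is of higher strength than the second.\<close>

definition higher_strength ::
  "('k::field \<Rightarrow> 'k) \<Rightarrow> ('k \<Rightarrow> 'k) \<Rightarrow> nat set \<Rightarrow> 'k spoly set \<Rightarrow> 'k spoly set \<Rightarrow> bool" where
  "higher_strength \<alpha>1 \<alpha>2 I S S' \<longleftrightarrow>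
     (\<exists>\<psi> \<psi>'. sigma_dim_poly \<alpha>1 \<alpha>2 I S \<psi> \<and> sigma_dim_poly \<alpha>1 \<alpha>2 I S' \<psi>' \<and>
        (\<forall>\<^sub>F r::int in at_top. poly \<psi> (of_int r) < poly \<psi>' (of_int r)))"


section \<open>Difference schemes for the mass balance equations\<close>

text \<open>The coefficients are the published ones. A literal discretization of the mass balance
  equation gives \<open>b = D i + u + 1\<close> in the forward scheme, and further terms in
  \<open>\<alpha>2\<close> and \<open>\<alpha>2\<^sup>-\<^sup>1\<close> of \<open>y\<close> with index \<open>2 i - 1\<close> in the symmetric one.
  The \<open>i\<close>-th equation involves only the indeterminates with indices \<open>2 i - 1\<close> and
  \<open>2 i\<close>, so the system for \<open>N\<close> components splits into \<open>N\<close> independent ones and its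
  dimension polynomial is \<open>N\<close> times that of one component.\<close>

definition forward_eq :: "'k::field \<Rightarrow> 'k \<Rightarrow> (nat \<Rightarrow> 'k) \<Rightarrow> nat \<Rightarrow> 'k spoly" where
  "forward_eq F u D i =
     (let a = - u - 2 * D i; b = - D i - u - 1 in
        cst (D i) * Y (2, 0) (2 * i - 1) + cst a * Y (1, 0) (2 * i - 1)
      - cst F * Y (0, 1) (2 * i) - Y (0, 1) (2 * i - 1)
      + cst F * Y (0, 0) (2 * i) + cst b * Y (0, 0) (2 * i - 1))"

definition symmetric_eq :: "'k::field \<Rightarrow> 'k \<Rightarrow> (nat \<Rightarrow> 'k) \<Rightarrow> nat \<Rightarrow> 'k spoly" where
  "symmetric_eq F u D i =
        cst (u - D i) * Y (1, 0) (2 * i - 1) - cst (u + D i) * Y (- 1, 0) (2 * i - 1)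
      + cst F * Y (0, 1) (2 * i) - cst F * Y (0, - 1) (2 * i)
      + cst (2 * D i) * Y (0, 0) (2 * i - 1)"

end

theory Submission
  imports Defs "HOL-Library.Product_Lexorder"
begin

text \<open>Both systems consist of linear equations, so everything reduces to linear algebra over the
  ground field. A linearly independent family of linear forms generates a prime ideal, because
  eliminating unknowns identifies the quotient with a polynomial ring (lemma \<open>elimination\<close>), and the
  transcendence degree of a subfield generated by images of indeterminates is the dimension of the
  space that these span modulo the equations (theorem \<open>linear_system\<close>).

  It remains to count the linear relations among the indeterminates of order at most \<open>r\<close>. The obvious
  ones are the translates \<open>\<gamma> A\<^sub>i\<close> whose terms all have order at most \<open>r\<close>. There are no others, by a
  Newton polygon argument: the ball \<open>\<Gamma>(r)\<close> is an intersection of four half-planes, and in each of the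
  four directions the highest terms of a combination of translates cannot cancel, since the equation
  itself has in that direction a highest term that is the only one of its kind (lemmas
  \<open>relation_corner\<close> and \<open>relation_trivial\<close>). As \<open>\<Gamma>(r)\<close> has \<open>2 r\<^sup>2 + 2 r + 1\<close> elements, the dimension
  polynomial of one component is \<open>4 r\<^sup>2 + 4 r + 2\<close> minus the number of admissible \<open>\<gamma>\<close>. That number is
  \<open>2 r\<^sup>2 - 3 r + 1\<close> for the forward and \<open>2 r\<^sup>2 - 2 r + 1\<close> for the symmetric scheme.\<close>

section \<open>The quotient field of a domain\<close>

context domain
begin

lemma fraction_mem_iff:
  assumes "a \<in> carrier R" "b \<in> carrier R - {\<zero>}"
  shows "(c, d) \<in> fraction R a b \<longleftrightarrow> c \<in> carrier R \<and> d \<in> carrier R - {\<zero>} \<and> a \<otimes> d = c \<otimes> b"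
  using assms by (auto simp: fraction_def frac_rel_def)

text \<open>Transitivity of cross-multiplication is the place where cancellation of the middle
  denominator, hence the domain property, enters.\<close>

lemma frac_rel_trans:
  assumes "a \<in> carrier R" "b \<in> carrier R - {\<zero>}" "c \<in> carrier R" "d \<in> carrier R - {\<zero>}"
    "e \<in> carrier R" "f \<in> carrier R - {\<zero>}" "a \<otimes> d = c \<otimes> b" "c \<otimes> f = e \<otimes> d"
  shows "a \<otimes> f = e \<otimes> b"
proof -
  have "d \<otimes> (a \<otimes> f) = (a \<otimes> d) \<otimes> f" using assms(1-6) by (simp add: m_ac)
  also have "\<dots> = (c \<otimes> f) \<otimes> b" unfolding assms(7) using assms(1-6) by (simp add: m_ac)
  also have "\<dots> = d \<otimes> (e \<otimes> b)" unfolding assms(8) using assms(1-6) by (simp add: m_ac)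
  finally show ?thesis using assms m_lcancel[of d "a \<otimes> f" "e \<otimes> b"] by auto
qed

lemma fraction_eq_iff:
  assumes "a \<in> carrier R" "b \<in> carrier R - {\<zero>}" "c \<in> carrier R" "d \<in> carrier R - {\<zero>}"
  shows "fraction R a b = fraction R c d \<longleftrightarrow> a \<otimes> d = c \<otimes> b"
proof
  assume "fraction R a b = fraction R c d"
  moreover have "(c, d) \<in> fraction R c d" using assms by (simp add: fraction_mem_iff)
  ultimately have "(c, d) \<in> fraction R a b" by simp
  then show "a \<otimes> d = c \<otimes> b" by (simp add: fraction_mem_iff[OF assms(1,2)])
next
  assume eq: "a \<otimes> d = c \<otimes> b"
  have "(x, y) \<in> fraction R a b \<longleftrightarrow> (x, y) \<in> fraction R c d" for x y
    unfolding fraction_mem_iff[OF assms(1,2)] fraction_mem_iff[OF assms(3,4)]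
    using frac_rel_trans[OF assms(3,4,1,2) _ _ eq[symmetric]] frac_rel_trans[OF assms _ _ eq]
    by blast
  then show "fraction R a b = fraction R c d" by auto
qed

lemma quot_field_carrier:
  "carrier (quot_field R) = {fraction R a b | a b. a \<in> carrier R \<and> b \<in> carrier R - {\<zero>}}"
  unfolding quot_field_def quotient_def fraction_def by auto

lemma quot_field_carrierE:
  assumes "x \<in> carrier (quot_field R)"
  obtains a b where "x = fraction R a b" "a \<in> carrier R" "b \<in> carrier R" "b \<noteq> \<zero>"
  using assms unfolding quot_field_carrier by auto

lemma fraction_closed:
  assumes "a \<in> carrier R" "b \<in> carrier R" "b \<noteq> \<zero>"
  shows "fraction R a b \<in> carrier (quot_field R)"
  using assms unfolding quot_field_carrier by auto

text \<open>The operations of the quotient field are unions over all representatives; they collapse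
  to a single fraction once the result is independent of the representatives.\<close>

lemma UN_fractions_const:
  assumes carr: "a \<in> carrier R" "b \<in> carrier R - {\<zero>}" "c \<in> carrier R" "d \<in> carrier R - {\<zero>}"
    and const: "\<And>a' b' c' d'. a' \<in> carrier R \<Longrightarrow> b' \<in> carrier R - {\<zero>} \<Longrightarrow> c' \<in> carrier R
      \<Longrightarrow> d' \<in> carrier R - {\<zero>} \<Longrightarrow> a \<otimes> b' = a' \<otimes> b \<Longrightarrow> c \<otimes> d' = c' \<otimes> d
      \<Longrightarrow> f a' b' c' d' = z"
  shows "(\<Union>(a', b')\<in>fraction R a b. \<Union>(c', d')\<in>fraction R c d. f a' b' c' d') = z"
proof -
  have ne: "(a, b) \<in> fraction R a b" "(c, d) \<in> fraction R c d"
    using carr by (simp_all add: fraction_mem_iff)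
  have "(\<Union>(c', d')\<in>fraction R c d. f a' b' c' d') = z" if "(a', b') \<in> fraction R a b" for a' b'
  proof -
    have "f a' b' c' d' = z" if "(c', d') \<in> fraction R c d" for c' d'
      using that \<open>(a', b') \<in> fraction R a b\<close>
      unfolding fraction_mem_iff[OF carr(1,2)] fraction_mem_iff[OF carr(3,4)]
      by (intro const) blast+
    then show ?thesis using UN_constant_eq[OF ne(2), of "\<lambda>(c', d'). f a' b' c' d'" z] by fast
  qed
  then show ?thesis
    using UN_constant_eq[OF ne(1), of "\<lambda>(a', b'). \<Union>(c', d')\<in>fraction R c d. f a' b' c' d'" z]
    by fast
qed

lemma fraction_mult:
  assumes "a \<in> carrier R" "b \<in> carrier R" "b \<noteq> \<zero>" "c \<in> carrier R" "d \<in> carrier R" "d \<noteq> \<zero>"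
  shows "fraction R a b \<otimes>\<^bsub>quot_field R\<^esub> fraction R c d = fraction R (a \<otimes> c) (b \<otimes> d)"
proof -
  have "fraction R (a' \<otimes> c') (b' \<otimes> d') = fraction R (a \<otimes> c) (b \<otimes> d)"
    if h: "a' \<in> carrier R" "b' \<in> carrier R - {\<zero>}" "c' \<in> carrier R" "d' \<in> carrier R - {\<zero>}"
      "a \<otimes> b' = a' \<otimes> b" "c \<otimes> d' = c' \<otimes> d" for a' b' c' d'
  proof -
    have "(a' \<otimes> c') \<otimes> (b \<otimes> d) = (a' \<otimes> b) \<otimes> (c' \<otimes> d)" using h(1-4) assms by (simp add: m_ac)
    also have "\<dots> = (a \<otimes> b') \<otimes> (c \<otimes> d')" using h by simp
    also have "\<dots> = (a \<otimes> c) \<otimes> (b' \<otimes> d')" using h(1-4) assms by (simp add: m_ac)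
    finally show ?thesis using h(1-4) assms by (subst fraction_eq_iff) (simp_all add: integral_iff)
  qed
  then show ?thesis unfolding quot_field_def monoid.select_convs ring.select_convs
    using assms by (intro UN_fractions_const) blast+
qed

lemma fraction_add:
  assumes "a \<in> carrier R" "b \<in> carrier R" "b \<noteq> \<zero>" "c \<in> carrier R" "d \<in> carrier R" "d \<noteq> \<zero>"
  shows "fraction R a b \<oplus>\<^bsub>quot_field R\<^esub> fraction R c d
    = fraction R (a \<otimes> d \<oplus> c \<otimes> b) (b \<otimes> d)"
proof -
  have "fraction R (a' \<otimes> d' \<oplus> c' \<otimes> b') (b' \<otimes> d') = fraction R (a \<otimes> d \<oplus> c \<otimes> b) (b \<otimes> d)"
    if h: "a' \<in> carrier R" "b' \<in> carrier R - {\<zero>}" "c' \<in> carrier R" "d' \<in> carrier R - {\<zero>}"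
      "a \<otimes> b' = a' \<otimes> b" "c \<otimes> d' = c' \<otimes> d" for a' b' c' d'
  proof -
    have "(a' \<otimes> d' \<oplus> c' \<otimes> b') \<otimes> (b \<otimes> d) = (a' \<otimes> b) \<otimes> (d' \<otimes> d) \<oplus> (c' \<otimes> d) \<otimes> (b' \<otimes> b)"
      using h(1-4) assms by (simp add: l_distr r_distr m_ac)
    also have "\<dots> = (a \<otimes> b') \<otimes> (d' \<otimes> d) \<oplus> (c \<otimes> d') \<otimes> (b' \<otimes> b)" using h by simp
    also have "\<dots> = (a \<otimes> d \<oplus> c \<otimes> b) \<otimes> (b' \<otimes> d')"
      using h(1-4) assms by (simp add: l_distr r_distr m_ac)
    finally show ?thesis using h(1-4) assms by (subst fraction_eq_iff) (simp_all add: integral_iff)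
  qed
  then show ?thesis unfolding quot_field_def monoid.select_convs ring.select_convs
    using assms by (intro UN_fractions_const) blast+
qed

lemma quot_field_one: "\<one>\<^bsub>quot_field R\<^esub> = fraction R \<one> \<one>"
  and quot_field_zero: "\<zero>\<^bsub>quot_field R\<^esub> = fraction R \<zero> \<one>"
  by (simp_all add: quot_field_def)

lemmas fraction_simps = fraction_mult fraction_add quot_field_one quot_field_zero
  fraction_closed integral_iff

lemma quot_field_cring: "cring (quot_field R)"
proof -
  define Q where "Q = carrier (quot_field R)"
  have QE: thesis if "x \<in> Q"
    "\<And>a b. x = fraction R a b \<Longrightarrow> a \<in> carrier R \<Longrightarrow> b \<in> carrier R \<Longrightarrow> b \<noteq> \<zero> \<Longrightarrow> thesis" for x thesis
    using that quot_field_carrierE unfolding Q_def by metis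
  show ?thesis
  proof (rule cringI, goal_cases)
    case 1
    show ?case
    proof (rule abelian_groupI, fold Q_def)
      fix x y z assume "x \<in> Q" "y \<in> Q" "z \<in> Q"
      from \<open>x \<in> Q\<close> obtain a b where x: "x = fraction R a b" "a \<in> carrier R" "b \<in> carrier R" "b \<noteq> \<zero>"
        by (rule QE)
      from \<open>y \<in> Q\<close> obtain c d where y: "y = fraction R c d" "c \<in> carrier R" "d \<in> carrier R" "d \<noteq> \<zero>"
        by (rule QE)
      from \<open>z \<in> Q\<close> obtain e f where z: "z = fraction R e f" "e \<in> carrier R" "f \<in> carrier R" "f \<noteq> \<zero>"
        by (rule QE)
      from x y z show "x \<oplus>\<^bsub>quot_field R\<^esub> y \<oplus>\<^bsub>quot_field R\<^esub> z = x \<oplus>\<^bsub>quot_field R\<^esub> (y \<oplus>\<^bsub>quot_field R\<^esub> z)"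
        by (simp add: fraction_simps l_distr r_distr m_ac a_ac)
    next
      fix x y assume "x \<in> Q" "y \<in> Q"
      from \<open>x \<in> Q\<close> obtain a b where x: "x = fraction R a b" "a \<in> carrier R" "b \<in> carrier R" "b \<noteq> \<zero>"
        by (rule QE)
      from \<open>y \<in> Q\<close> obtain c d where y: "y = fraction R c d" "c \<in> carrier R" "d \<in> carrier R" "d \<noteq> \<zero>"
        by (rule QE)
      from x y show "x \<oplus>\<^bsub>quot_field R\<^esub> y \<in> Q"
        "x \<oplus>\<^bsub>quot_field R\<^esub> y = y \<oplus>\<^bsub>quot_field R\<^esub> x"
        unfolding Q_def by (simp_all add: fraction_simps m_ac a_ac)
    next
      show "\<zero>\<^bsub>quot_field R\<^esub> \<in> Q" unfolding Q_def by (simp add: fraction_simps)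
    next
      fix x assume "x \<in> Q"
      then obtain a b where x: "x = fraction R a b" "a \<in> carrier R" "b \<in> carrier R" "b \<noteq> \<zero>"
        by (rule QE)
      then show "\<zero>\<^bsub>quot_field R\<^esub> \<oplus>\<^bsub>quot_field R\<^esub> x = x" by (simp add: fraction_simps)
      have "fraction R (\<ominus> a) b \<oplus>\<^bsub>quot_field R\<^esub> x = \<zero>\<^bsub>quot_field R\<^esub>"
        using x by (simp add: fraction_simps fraction_eq_iff l_minus l_neg)
      then show "\<exists>y\<in>Q. y \<oplus>\<^bsub>quot_field R\<^esub> x = \<zero>\<^bsub>quot_field R\<^esub>"
        using x unfolding Q_def
        by (intro bexI[of _ "fraction R (\<ominus> a) b"]) (auto simp: fraction_closed)
    qed
  next
    case 2
    show ?case
    proof (rule comm_monoidI, fold Q_def)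
      fix x y z assume "x \<in> Q" "y \<in> Q" "z \<in> Q"
      from \<open>x \<in> Q\<close> obtain a b where x: "x = fraction R a b" "a \<in> carrier R" "b \<in> carrier R" "b \<noteq> \<zero>"
        by (rule QE)
      from \<open>y \<in> Q\<close> obtain c d where y: "y = fraction R c d" "c \<in> carrier R" "d \<in> carrier R" "d \<noteq> \<zero>"
        by (rule QE)
      from \<open>z \<in> Q\<close> obtain e f where z: "z = fraction R e f" "e \<in> carrier R" "f \<in> carrier R" "f \<noteq> \<zero>"
        by (rule QE)
      from x y z show "x \<otimes>\<^bsub>quot_field R\<^esub> y \<otimes>\<^bsub>quot_field R\<^esub> z = x \<otimes>\<^bsub>quot_field R\<^esub> (y \<otimes>\<^bsub>quot_field R\<^esub> z)"
        "x \<otimes>\<^bsub>quot_field R\<^esub> y \<in> Q" "x \<otimes>\<^bsub>quot_field R\<^esub> y = y \<otimes>\<^bsub>quot_field R\<^esub> x"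
        "\<one>\<^bsub>quot_field R\<^esub> \<otimes>\<^bsub>quot_field R\<^esub> x = x"
        unfolding Q_def by (simp_all add: fraction_simps m_ac)
    qed (simp add: fraction_simps Q_def)
  next
    case (3 x y z)
    then have "x \<in> Q" "y \<in> Q" "z \<in> Q" unfolding Q_def .
    from \<open>x \<in> Q\<close> obtain a b where x: "x = fraction R a b" "a \<in> carrier R" "b \<in> carrier R" "b \<noteq> \<zero>"
        by (rule QE)
      from \<open>y \<in> Q\<close> obtain c d where y: "y = fraction R c d" "c \<in> carrier R" "d \<in> carrier R" "d \<noteq> \<zero>"
        by (rule QE)
      from \<open>z \<in> Q\<close> obtain e f where z: "z = fraction R e f" "e \<in> carrier R" "f \<in> carrier R" "f \<noteq> \<zero>"
        by (rule QE)
      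
    have "(a \<otimes> d \<oplus> c \<otimes> b) \<otimes> e \<otimes> (b \<otimes> f \<otimes> (d \<otimes> f))
      = (a \<otimes> e \<otimes> (d \<otimes> f) \<oplus> c \<otimes> e \<otimes> (b \<otimes> f)) \<otimes> (b \<otimes> d \<otimes> f)"
      using x(2-) y(2-) z(2-) by (simp add: l_distr r_distr m_ac)
    then show ?case using x(2-) y(2-) z(2-) unfolding x(1) y(1) z(1)
      by (simp add: fraction_simps fraction_eq_iff)
  qed
qed

lemma quot_field_field: "field (quot_field R)"
proof (rule cring.cring_fieldI2[OF quot_field_cring])
  show "\<zero>\<^bsub>quot_field R\<^esub> \<noteq> \<one>\<^bsub>quot_field R\<^esub>" by (simp add: fraction_simps fraction_eq_iff)
  fix x assume "x \<in> carrier (quot_field R)" and nz: "x \<noteq> \<zero>\<^bsub>quot_field R\<^esub>"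
  then obtain a b where x: "x = fraction R a b" "a \<in> carrier R" "b \<in> carrier R" "b \<noteq> \<zero>"
    by (elim quot_field_carrierE)
  with nz have a: "a \<noteq> \<zero>" by (auto simp: fraction_simps fraction_eq_iff)
  show "\<exists>y\<in>carrier (quot_field R). x \<otimes>\<^bsub>quot_field R\<^esub> y = \<one>\<^bsub>quot_field R\<^esub>"
    using x a by (intro bexI[of _ "fraction R b a"]) (auto simp: fraction_simps fraction_eq_iff m_ac)
qed

lemma fraction_ring_hom: "(\<lambda>a. fraction R a \<one>) \<in> ring_hom R (quot_field R)"
  by (rule ring_hom_memI) (simp_all add: fraction_simps fraction_eq_iff)

end

section \<open>Substitution in difference polynomials\<close>

lemma cst_zero [simp]: "cst 0 = 0" and cst_one [simp]: "cst 1 = 1"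
  and cst_add: "cst (a + b) = cst a + cst b"
  and cst_minus: "cst (- c) = - cst (c::'k::field)"
  and cst_mult: "cst (c * d) = cst c * (cst d :: 'k spoly)"
  by (simp_all add: cst_def single_add single_uminus mult_single)

lemma cst_Y: "cst c * Y g i = Poly_Mapping.single (Poly_Mapping.single (i, g) 1) (c::'k::field)"
  by (simp add: cst_def Y_def mult_single)

text \<open>Linear algebra over the coefficient field: linear forms are the span of the
  indeterminates inside this vector space.\<close>

interpretation spoly: vector_space "\<lambda>(c::'k::field) (p::'k spoly). cst c * p"
  by unfold_locales (simp_all add: cst_add cst_mult algebra_simps)

interpretation spoly_pair: vector_space_pair "\<lambda>(c::'k::field) (p::'k spoly). cst c * p"
    "\<lambda>(c::'k::field) (p::'k spoly). cst c * p" ..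

text \<open>Substitution of difference polynomials for variables. The variables range over an
  arbitrary type because two kinds occur: the indeterminates themselves, and elements of the
  quotient field, which serve as variables in the definition of algebraic independence.\<close>

definition monom_at :: "('a \<Rightarrow> 'k::field spoly) \<Rightarrow> ('a \<Rightarrow>\<^sub>0 nat) \<Rightarrow> 'k spoly" where
  "monom_at f m = (\<Prod>x\<in>Poly_Mapping.keys m. f x ^ Poly_Mapping.lookup m x)"

definition poly_at :: "('a \<Rightarrow> 'k::field spoly) \<Rightarrow> (('a \<Rightarrow>\<^sub>0 nat) \<Rightarrow>\<^sub>0 'k) \<Rightarrow> 'k spoly" where
  "poly_at f p = (\<Sum>m\<in>Poly_Mapping.keys p. cst (Poly_Mapping.lookup p m) * monom_at f m)"

lemma monom_at_superset:
  assumes "finite S" "Poly_Mapping.keys m \<subseteq> S"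
  shows "monom_at f m = (\<Prod>x\<in>S. f x ^ Poly_Mapping.lookup m x)"
  unfolding monom_at_def using assms
  by (intro prod.mono_neutral_left) (auto simp: in_keys_iff)

lemma monom_at_add: "monom_at f (m + n) = monom_at f m * monom_at f n"
proof -
  let ?S = "Poly_Mapping.keys m \<union> Poly_Mapping.keys n"
  have "monom_at f (m + n) = (\<Prod>x\<in>?S. f x ^ Poly_Mapping.lookup (m + n) x)"
    by (rule monom_at_superset) (auto dest: subsetD[OF keys_add])
  also have "\<dots> = monom_at f m * monom_at f n"
    by (simp add: monom_at_superset[of ?S] lookup_add power_add prod.distrib)
  finally show ?thesis .
qed

lemma monom_at_zero [simp]: "monom_at f 0 = 1"
  by (simp add: monom_at_def)

lemma monom_at_single: "monom_at f (Poly_Mapping.single x 1) = f x"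
  by (simp add: monom_at_def)

lemma poly_at_superset:
  assumes "finite S" "Poly_Mapping.keys p \<subseteq> S"
  shows "poly_at f p = (\<Sum>m\<in>S. cst (Poly_Mapping.lookup p m) * monom_at f m)"
  unfolding poly_at_def using assms
  by (intro sum.mono_neutral_left) (auto simp: in_keys_iff)

lemma poly_at_add: "poly_at f (p + q) = poly_at f p + poly_at f q"
proof -
  let ?S = "Poly_Mapping.keys p \<union> Poly_Mapping.keys q"
  have "poly_at f (p + q) = (\<Sum>m\<in>?S. cst (Poly_Mapping.lookup (p + q) m) * monom_at f m)"
    by (rule poly_at_superset) (auto dest: subsetD[OF keys_add])
  also have "\<dots> = poly_at f p + poly_at f q"
    by (simp add: poly_at_superset[of ?S] lookup_add cst_add algebra_simps sum.distrib)
  finally show ?thesis .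
qed

lemma poly_at_zero [simp]: "poly_at f 0 = 0"
  by (simp add: poly_at_def)

lemma poly_at_sum: "poly_at f (sum p A) = (\<Sum>x\<in>A. poly_at f (p x))"
  by (induction A rule: infinite_finite_induct) (simp_all add: poly_at_add)

lemma poly_at_single: "poly_at f (Poly_Mapping.single m c) = cst c * monom_at f m"
  by (simp add: poly_at_def)

lemma poly_at_cst [simp]: "poly_at f (cst c) = cst c"
  by (simp add: cst_def poly_at_single)

lemma poly_at_Y: "poly_at f (Y g i) = f (i, g)"
  unfolding Y_def poly_at_single monom_at_single by simp

lemma sum_of_monomials:
  "p = (\<Sum>m\<in>Poly_Mapping.keys p. Poly_Mapping.single m (Poly_Mapping.lookup p m))"
  by (rule poly_mapping_eqI)
    (auto simp: lookup_sum lookup_single when_def in_keys_iff sum.delta' split: if_splits)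

lemma poly_at_mult: "poly_at f (p * q) = poly_at f p * poly_at f (q :: 'k::field spoly)"
proof -
  let ?s = "\<lambda>p m. Poly_Mapping.single m (Poly_Mapping.lookup p m)"
  have "p * q = (\<Sum>m\<in>Poly_Mapping.keys p. ?s p m) * (\<Sum>n\<in>Poly_Mapping.keys q. ?s q n)"
    using sum_of_monomials[of p] sum_of_monomials[of q] by simp
  then have "poly_at f (p * q) = (\<Sum>m\<in>Poly_Mapping.keys p. \<Sum>n\<in>Poly_Mapping.keys q.
      (cst (Poly_Mapping.lookup p m) * monom_at f m) * (cst (Poly_Mapping.lookup q n) * monom_at f n))"
    by (simp only: sum_product poly_at_sum mult_single poly_at_single monom_at_add cst_mult mult_ac)
  then show ?thesis unfolding poly_at_def sum_product .
qed

lemma poly_at_one [simp]: "poly_at f 1 = (1 :: 'k::field spoly)"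
  unfolding single_one[symmetric] poly_at_single by simp

lemma poly_at_power: "poly_at f (p ^ n) = poly_at f (p :: 'k::field spoly) ^ n"
  by (induction n) (simp_all add: poly_at_mult)

lemma poly_at_prod: "poly_at f (prod p A) = (\<Prod>x\<in>A. poly_at f (p x :: 'k::field spoly))"
  by (induction A rule: infinite_finite_induct) (simp_all add: poly_at_mult)

lemma poly_at_diff: "poly_at f (p - q) = poly_at f p - poly_at f q"
  using poly_at_add[of f "p - q" q] by simp

lemma poly_at_poly_at:
  "poly_at f (poly_at g p) = poly_at (\<lambda>x. poly_at f (g x)) p"
  by (simp add: poly_at_def[of g] poly_at_def[of "\<lambda>x. poly_at f (g x)"] monom_at_def
      poly_at_sum poly_at_mult poly_at_prod poly_at_power)

lemma poly_at_cong:
  assumes "\<And>m x. m \<in> Poly_Mapping.keys p \<Longrightarrow> x \<in> Poly_Mapping.keys m \<Longrightarrow> f x = g x"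
  shows "poly_at f p = poly_at g p"
  unfolding poly_at_def monom_at_def using assms by (auto intro!: sum.cong prod.cong)

lemma single_sum: "Poly_Mapping.single (sum f A) 1 = (\<Prod>x\<in>A. Poly_Mapping.single (f x) (1::'k::field))"
proof (induction A rule: infinite_finite_induct)
  case (insert x F)
  have "Poly_Mapping.single (f x + sum f F) (1::'k)
      = Poly_Mapping.single (f x) 1 * Poly_Mapping.single (sum f F) 1"
    by (simp add: mult_single)
  with insert show ?case by simp
qed simp_all

lemma Y_power: "Y g i ^ n = Poly_Mapping.single (Poly_Mapping.single (i, g) n) (1::'k::field)"
  by (induction n) (simp_all add: Y_def mult_single single_add[symmetric])

lemma monom_at_Y:
  fixes g :: "'a \<Rightarrow> svar"
  shows "monom_at (\<lambda>x. Y (snd (g x)) (fst (g x)) :: 'k::field spoly) m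
   = Poly_Mapping.single (\<Sum>x\<in>Poly_Mapping.keys m. Poly_Mapping.single (g x) (Poly_Mapping.lookup m x)) 1"
  unfolding monom_at_def Y_power single_sum by simp

text \<open>An injective renaming of variables sends distinct monomials to distinct monomials, so it
  cannot create cancellation. It transfers relations among elements of a field to relations
  among indeterminates.\<close>

lemma poly_at_renaming_eq_0:
  fixes g :: "'a \<Rightarrow> svar"
  assumes inj: "inj_on g B" and keys: "\<And>m. m \<in> Poly_Mapping.keys p \<Longrightarrow> Poly_Mapping.keys m \<subseteq> B"
    and zero: "poly_at (\<lambda>x. Y (snd (g x)) (fst (g x))) p = (0 :: 'k::field spoly)"
  shows "p = 0"
proof (rule ccontr)
  let ?r = "\<lambda>m. \<Sum>x\<in>Poly_Mapping.keys m. Poly_Mapping.single (g x) (Poly_Mapping.lookup m x)"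
  have look: "Poly_Mapping.lookup (?r m) (g x) = Poly_Mapping.lookup m x"
    if "Poly_Mapping.keys m \<subseteq> B" "x \<in> B" for m x
  proof -
    have "Poly_Mapping.lookup (?r m) (g x)
       = (\<Sum>y\<in>Poly_Mapping.keys m. if y = x then Poly_Mapping.lookup m y else 0)"
      unfolding lookup_sum using that inj_onD[OF inj]
      by (intro sum.cong) (auto simp: lookup_single when_def)
    then show ?thesis by (simp add: in_keys_iff)
  qed
  have inj_r: "m = n" if "Poly_Mapping.keys m \<subseteq> B" "Poly_Mapping.keys n \<subseteq> B" "?r m = ?r n" for m n
  proof (rule poly_mapping_eqI)
    fix x
    show "Poly_Mapping.lookup m x = Poly_Mapping.lookup n x"
    proof (cases "x \<in> B")
      case True
      have "Poly_Mapping.lookup m x = Poly_Mapping.lookup (?r m) (g x)"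
        using look[OF that(1) True] by (rule sym)
      also have "\<dots> = Poly_Mapping.lookup (?r n) (g x)" by (simp only: that(3))
      also have "\<dots> = Poly_Mapping.lookup n x" using that(2) True by (rule look)
      finally show ?thesis .
    next
      case False
      then show ?thesis using that by (metis in_keys_iff subsetD)
    qed
  qed
  assume "p \<noteq> 0"
  then obtain m where m: "m \<in> Poly_Mapping.keys p" by (metis keys_eq_empty ex_in_conv)
  have "0 = Poly_Mapping.lookup (poly_at (\<lambda>x. Y (snd (g x)) (fst (g x))) p :: 'k spoly) (?r m)"
    using zero by simp
  also have "\<dots> = (\<Sum>n\<in>Poly_Mapping.keys p. if n = m then Poly_Mapping.lookup p n else 0)"
    unfolding poly_at_def monom_at_Y lookup_sum using inj_r keys m
    by (intro sum.cong) (auto simp: cst_def mult_single lookup_single when_def)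
  also have "\<dots> = Poly_Mapping.lookup p m" using m by simp
  finally show False using m by (simp add: in_keys_iff)
qed

lemma poly_at_Y_id: "poly_at (\<lambda>v. Y (snd v) (fst v)) p = (p :: 'k::field spoly)"
proof -
  have "monom_at (\<lambda>v. Y (snd v) (fst v) :: 'k spoly) m = Poly_Mapping.single m 1" for m
    using monom_at_Y[of id m] sum_of_monomials[of m] by simp
  then show ?thesis
    unfolding poly_at_def using sum_of_monomials[of p] by (simp add: cst_def mult_single)
qed

section \<open>The ring of difference polynomials\<close>

lemma spoly_ring_simps [simp]:
  "monoid.mult (spoly_ring I) = (*)" "one (spoly_ring I) = 1" "zero (spoly_ring I) = 0"
  "add (spoly_ring I) = (+)"
  by (simp_all add: spoly_ring_def)

lemma spoly_carrier: "p \<in> carrier (spoly_ring I) \<longleftrightarrow>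
    (\<forall>m\<in>Poly_Mapping.keys p. \<forall>v\<in>Poly_Mapping.keys m. fst v \<in> I)"
  by (simp add: spoly_ring_def)

lemma spoly_carrier_closed:
  fixes p q :: "'k::field spoly"
  assumes "p \<in> carrier (spoly_ring I)" "q \<in> carrier (spoly_ring I)"
  shows "p + q \<in> carrier (spoly_ring I)" "p * q \<in> carrier (spoly_ring I)"
    "- p \<in> carrier (spoly_ring I)"
proof -
  show "p + q \<in> carrier (spoly_ring I)" using assms keys_add[of p q] unfolding spoly_carrier by blast
  show "- p \<in> carrier (spoly_ring I)" using assms unfolding spoly_carrier by (simp add: in_keys_iff)
  have "fst v \<in> I" if mem: "m \<in> Poly_Mapping.keys (p * q)" "v \<in> Poly_Mapping.keys m" for m v
  proof -
    obtain a b where ab: "m = a + b" "a \<in> Poly_Mapping.keys p" "b \<in> Poly_Mapping.keys q"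
      using keys_mult[of p q] mem(1) by blast
    then have "v \<in> Poly_Mapping.keys a \<or> v \<in> Poly_Mapping.keys b"
      using mem(2) keys_add[of a b] by blast
    then show ?thesis using ab assms unfolding spoly_carrier by blast
  qed
  then show "p * q \<in> carrier (spoly_ring I)" unfolding spoly_carrier by blast
qed

lemma cst_carrier [simp]: "cst c \<in> carrier (spoly_ring I)"
  and one_carrier [simp]: "1 \<in> carrier (spoly_ring I)"
  and zero_carrier [simp]: "0 \<in> carrier (spoly_ring I)"
  by (auto simp: spoly_carrier cst_def)

lemma Y_carrier: "i \<in> I \<Longrightarrow> Y g i \<in> carrier (spoly_ring I)"
  by (auto simp: spoly_carrier Y_def)

text \<open>The monomials form a linearly ordered cancellative monoid (the indeterminates being ordered
  lexicographically), so leading terms multiply and there are no zero divisors.\<close>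

lemma spoly_ring_domain: "domain (spoly_ring I :: 'k::field spoly ring)"
proof -
  have "cring (spoly_ring I :: 'k spoly ring)"
  proof (rule cringI)
    show "abelian_group (spoly_ring I :: 'k spoly ring)"
      by (rule abelian_groupI)
        (auto simp: spoly_carrier_closed add_ac intro!: bexI[of _ "- x" for x])
    show "Group.comm_monoid (spoly_ring I :: 'k spoly ring)"
      by (rule comm_monoidI) (auto simp: spoly_carrier_closed mult_ac)
  qed (auto simp: algebra_simps)
  then show ?thesis by (intro domain.intro domain_axioms.intro) auto
qed

lemma spoly_finsum: "finite A \<Longrightarrow> f \<in> A \<rightarrow> carrier (spoly_ring I) \<Longrightarrow>
    finsum (spoly_ring I) f A = (\<Sum>x\<in>A. f x :: 'k::field spoly)"
proof (induction A rule: finite_induct)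
  interpret domain "spoly_ring I :: 'k spoly ring" by (rule spoly_ring_domain)
  case empty
  then show ?case by simp
next
  interpret domain "spoly_ring I :: 'k spoly ring" by (rule spoly_ring_domain)
  case (insert x F)
  then show ?case by simp
qed

lemma spoly_finprod: "finite A \<Longrightarrow> f \<in> A \<rightarrow> carrier (spoly_ring I) \<Longrightarrow>
    finprod (spoly_ring I) f A = (\<Prod>x\<in>A. f x :: 'k::field spoly)"
proof (induction A rule: finite_induct)
  interpret domain "spoly_ring I :: 'k spoly ring" by (rule spoly_ring_domain)
  case empty
  then show ?case by simp
next
  interpret domain "spoly_ring I :: 'k spoly ring" by (rule spoly_ring_domain)
  case (insert x F)
  then show ?case by simp
qed

lemma power_carrier: "p \<in> carrier (spoly_ring I) \<Longrightarrow> (p :: 'k::field spoly) ^ n \<in> carrier (spoly_ring I)"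
  by (induction n) (simp_all add: spoly_carrier_closed)

lemma sum_carrier: "(\<And>x. x \<in> A \<Longrightarrow> f x \<in> carrier (spoly_ring I)) \<Longrightarrow>
   (\<Sum>x\<in>A. f x :: 'k::field spoly) \<in> carrier (spoly_ring I)"
  by (induction A rule: infinite_finite_induct) (simp_all add: spoly_carrier_closed)

lemma prod_carrier: "(\<And>x. x \<in> A \<Longrightarrow> f x \<in> carrier (spoly_ring I)) \<Longrightarrow>
   (\<Prod>x\<in>A. f x :: 'k::field spoly) \<in> carrier (spoly_ring I)"
  by (induction A rule: infinite_finite_induct) (simp_all add: spoly_carrier_closed)

lemma poly_at_carrier:
  assumes "\<And>m x. m \<in> Poly_Mapping.keys p \<Longrightarrow> x \<in> Poly_Mapping.keys m \<Longrightarrow> f x \<in> carrier (spoly_ring I)"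
  shows "poly_at f p \<in> carrier (spoly_ring I)"
  unfolding poly_at_def monom_at_def using assms
  by (intro sum_carrier spoly_carrier_closed prod_carrier power_carrier) auto

text \<open>With \<open>e = id\<close> on the relevant variables, the right-hand side is the evaluation used in the
  definition of algebraic independence; thus that evaluation is the image of a substitution.\<close>

lemma hom_poly_at:
  fixes f :: "'a \<Rightarrow> 'k::field spoly"
  assumes h: "ring_hom_cring (spoly_ring I) L h"
    and f: "\<And>m x. m \<in> Poly_Mapping.keys p \<Longrightarrow> x \<in> Poly_Mapping.keys m \<Longrightarrow> f x \<in> carrier (spoly_ring I)"
    and e: "\<And>m x. m \<in> Poly_Mapping.keys p \<Longrightarrow> x \<in> Poly_Mapping.keys m \<Longrightarrow> h (f x) = e x"
  shows "h (poly_at f p) = (\<Oplus>\<^bsub>L\<^esub>m\<in>Poly_Mapping.keys p. h (cst (Poly_Mapping.lookup p m)) \<otimes>\<^bsub>L\<^esub>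
       (\<Otimes>\<^bsub>L\<^esub>x\<in>Poly_Mapping.keys m. e x [^]\<^bsub>L\<^esub> Poly_Mapping.lookup m x))"
proof -
  interpret h: ring_hom_cring "spoly_ring I" L h by (rule h)
  have pow: "h (q ^ n) = h q [^]\<^bsub>L\<^esub> n" if "q \<in> carrier (spoly_ring I)" for q n
  proof (induction n)
    case 0
    show ?case using h.hom_one by simp
  next
    case (Suc n)
    have "h (q ^ Suc n) = h (q ^ n) \<otimes>\<^bsub>L\<^esub> h q"
      using h.hom_mult[OF power_carrier[OF that, of n] that] by (simp add: mult.commute)
    then show ?case using Suc by simp
  qed
  have mon: "monom_at f m \<in> carrier (spoly_ring I)" if "m \<in> Poly_Mapping.keys p" for m
    unfolding monom_at_def using f that by (intro prod_carrier power_carrier)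
  have hmon: "h (monom_at f m) = (\<Otimes>\<^bsub>L\<^esub>x\<in>Poly_Mapping.keys m. e x [^]\<^bsub>L\<^esub> Poly_Mapping.lookup m x)"
    if m: "m \<in> Poly_Mapping.keys p" for m
  proof -
    have c: "(\<lambda>x. f x ^ Poly_Mapping.lookup m x) \<in> Poly_Mapping.keys m \<rightarrow> carrier (spoly_ring I)"
      using f[OF m] by (auto intro: power_carrier)
    have "h (monom_at f m) = h (finprod (spoly_ring I) (\<lambda>x. f x ^ Poly_Mapping.lookup m x) (Poly_Mapping.keys m))"
      unfolding monom_at_def using c by (simp add: spoly_finprod)
    also have "\<dots> = finprod L (h \<circ> (\<lambda>x. f x ^ Poly_Mapping.lookup m x)) (Poly_Mapping.keys m)"
      using c by (rule h.hom_finprod)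
    also have "\<dots> = (\<Otimes>\<^bsub>L\<^esub>x\<in>Poly_Mapping.keys m. e x [^]\<^bsub>L\<^esub> Poly_Mapping.lookup m x)"
      using f[OF m] by (intro h.S.finprod_cong') (auto simp: pow simp flip: e[OF m])
    finally show ?thesis .
  qed
  have c: "(\<lambda>m. cst (Poly_Mapping.lookup p m) * monom_at f m) \<in> Poly_Mapping.keys p \<rightarrow> carrier (spoly_ring I)"
    using mon by (auto intro: spoly_carrier_closed)
  have "h (poly_at f p) = h (finsum (spoly_ring I) (\<lambda>m. cst (Poly_Mapping.lookup p m) * monom_at f m) (Poly_Mapping.keys p))"
    unfolding poly_at_def using c by (simp add: spoly_finsum)
  also have "\<dots> = finsum L (h \<circ> (\<lambda>m. cst (Poly_Mapping.lookup p m) * monom_at f m)) (Poly_Mapping.keys p)"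
    using c by (rule h.hom_finsum)
  also have "\<dots> = (\<Oplus>\<^bsub>L\<^esub>m\<in>Poly_Mapping.keys p. h (cst (Poly_Mapping.lookup p m)) \<otimes>\<^bsub>L\<^esub>
       (\<Otimes>\<^bsub>L\<^esub>x\<in>Poly_Mapping.keys m. e x [^]\<^bsub>L\<^esub> Poly_Mapping.lookup m x))"
    using mon h.hom_mult[of "cst c" for c]
    by (intro h.S.finsum_cong') (auto simp flip: hmon)
  finally show ?thesis .
qed

lemma hom_poly_at_cong:
  fixes f g :: "'a \<Rightarrow> 'k::field spoly"
  assumes h: "ring_hom_cring (spoly_ring I) L h"
    and carr: "\<And>m x. m \<in> Poly_Mapping.keys p \<Longrightarrow> x \<in> Poly_Mapping.keys m \<Longrightarrow>
      f x \<in> carrier (spoly_ring I) \<and> g x \<in> carrier (spoly_ring I) \<and> h (f x) = h (g x)"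
  shows "h (poly_at f p) = h (poly_at g p)"
  using hom_poly_at[OF h, of p f "\<lambda>x. h (g x)"] hom_poly_at[OF h, of p g "\<lambda>x. h (g x)"] carr
  by simp

section \<open>Ideals generated by linear forms\<close>

abbreviation indet :: "svar \<Rightarrow> 'k::field spoly" where "indet v \<equiv> Y (snd v) (fst v)"

lemma indet_eq: "indet v = Poly_Mapping.single (Poly_Mapping.single v 1) 1"
  by (simp add: Y_def)

lemma indet_inject: "indet v = (indet w :: 'k::field spoly) \<longleftrightarrow> v = w"
proof
  assume "indet v = (indet w :: 'k spoly)"
  then have "Poly_Mapping.keys (indet v :: 'k spoly) = Poly_Mapping.keys (indet w :: 'k spoly)" by simp
  then have "Poly_Mapping.keys (Poly_Mapping.single v (1::nat)) = Poly_Mapping.keys (Poly_Mapping.single w (1::nat))"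
    unfolding indet_eq by simp
  then show "v = w" by simp
qed simp

lemma spoly_ideal_closed:
  fixes P :: "'k::field spoly set"
  assumes "ideal P (spoly_ring I)"
  shows "P \<subseteq> carrier (spoly_ring I)" "0 \<in> P" "\<And>p q. p \<in> P \<Longrightarrow> q \<in> P \<Longrightarrow> p + q \<in> P"
    "\<And>p q. p \<in> P \<Longrightarrow> q \<in> carrier (spoly_ring I) \<Longrightarrow> q * p \<in> P"
proof -
  interpret ideal P "spoly_ring I" by fact
  show "P \<subseteq> carrier (spoly_ring I)" by (rule a_subset)
  show "0 \<in> P" using additive_subgroup.zero_closed[OF additive_subgroup_axioms] by simp
  show "\<And>p q. p \<in> P \<Longrightarrow> q \<in> P \<Longrightarrow> p + q \<in> P"
    using additive_subgroup.a_closed[OF additive_subgroup_axioms] by simp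
  show "\<And>p q. p \<in> P \<Longrightarrow> q \<in> carrier (spoly_ring I) \<Longrightarrow> q * p \<in> P" using I_l_closed by simp
qed

lemma spoly_ideal_span:
  fixes P :: "'k::field spoly set"
  assumes "ideal P (spoly_ring I)" "G \<subseteq> P"
  shows "spoly.span G \<subseteq> P"
  using assms by (intro spoly.span_minimal spoly.subspaceI) (auto intro: spoly_ideal_closed)

lemma spoly_ring_minus:
  "p \<in> carrier (spoly_ring I) \<Longrightarrow> q \<in> carrier (spoly_ring I) \<Longrightarrow>
   p \<ominus>\<^bsub>spoly_ring I\<^esub> q = p - (q :: 'k::field spoly)"
proof -
  assume pq: "p \<in> carrier (spoly_ring I)" "q \<in> carrier (spoly_ring I)"
  interpret domain "spoly_ring I :: 'k spoly ring" by (rule spoly_ring_domain)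
  have "\<ominus>\<^bsub>spoly_ring I\<^esub> q = - q"
    using pq by (intro minus_equality) (auto simp: spoly_carrier_closed)
  then show ?thesis by (simp add: a_minus_def)
qed

lemma spoly_coset_eq_iff:
  fixes P :: "'k::field spoly set"
  assumes "ideal P (spoly_ring I)" "p \<in> carrier (spoly_ring I)" "q \<in> carrier (spoly_ring I)"
  shows "P +>\<^bsub>spoly_ring I\<^esub> p = P +>\<^bsub>spoly_ring I\<^esub> q \<longleftrightarrow> p - q \<in> P"
proof -
  interpret ideal P "spoly_ring I" by fact
  have "p - q \<in> P \<longleftrightarrow> p \<in> P +>\<^bsub>spoly_ring I\<^esub> q"
    using a_rcos_module_minus[OF ring_axioms, of q p] assms by (simp add: spoly_ring_minus)
  then show ?thesis using a_repr_independence'[of p q] a_rcos_self[of p] assms by auto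
qed

definition svars :: "nat set \<Rightarrow> svar set" where "svars I = {v. fst v \<in> I}"

text \<open>Gaussian elimination in infinitely many unknowns. The independent set \<open>G\<close> together with
  the indeterminates in \<open>B\<close> extends, by further indeterminates, to a basis of the linear forms.
  The linear projection that kills \<open>G\<close> and fixes the rest of the basis prescribes a substitution
  \<open>f\<close>. It kills \<open>G\<close>, and it changes every polynomial only by an element of the ideal; therefore
  its kernel is exactly the ideal. A basis adapted to \<open>B\<close> makes \<open>f\<close> fix \<open>B\<close> pointwise.\<close>

lemma elimination:
  fixes G :: "'k::field spoly set" and B :: "svar set"
  assumes G: "G \<subseteq> spoly.span (indet ` svars I)" and B: "B \<subseteq> svars I"
    and ind: "spoly.independent (G \<union> indet ` B)" and disj: "G \<inter> indet ` B = {}"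
  obtains f where "\<And>v. v \<in> svars I \<Longrightarrow> f v \<in> carrier (spoly_ring I)"
    "genideal (spoly_ring I) G = {p \<in> carrier (spoly_ring I). poly_at f p = 0}"
    "\<And>v. v \<in> B \<Longrightarrow> f v = indet v"
proof -
  let ?R = "spoly_ring I :: 'k spoly ring"
  define V where "V = svars I"
  note G = G[folded V_def] and B = B[folded V_def]
  interpret R: domain ?R by (rule spoly_ring_domain)
  let ?P = "genideal ?R G"
  have YV: "indet ` V \<subseteq> carrier ?R" by (auto simp: V_def svars_def Y_carrier)
  have spanR: "spoly.span W \<subseteq> carrier ?R" if "W \<subseteq> carrier ?R" for W
    using that R.oneideal spoly_ideal_span by blast
  have GR: "G \<subseteq> carrier ?R" using G spanR[OF YV] by (rule subset_trans)
  have P: "ideal ?P ?R" using GR by (rule R.genideal_ideal)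
  have GP: "spoly.span G \<subseteq> ?P" using spoly_ideal_span[OF P] R.genideal_self[OF GR] by blast
  have PR: "?P \<subseteq> carrier ?R" by (rule spoly_ideal_closed(1)[OF P])
  obtain C where C: "G \<union> indet ` B \<subseteq> C" "C \<subseteq> G \<union> indet ` V" "spoly.independent C"
    "G \<union> indet ` V \<subseteq> spoly.span C"
    using spoly.maximal_independent_subset_extend[OF _ ind, of "G \<union> indet ` V"] B by blast
  define g where "g = spoly_pair.construct C (\<lambda>x. if x \<in> G then 0 else x)"
  have lin: "Vector_Spaces.linear (\<lambda>(c::'k) p. cst c * p) (\<lambda>c p. cst c * p) g"
    unfolding g_def using C(3) by (rule spoly_pair.linear_construct)
  interpret g: Vector_Spaces.linear "\<lambda>(c::'k) (p::'k spoly). cst c * p"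
      "\<lambda>(c::'k) (p::'k spoly). cst c * p" g by (rule lin)
  have gC: "g x = (if x \<in> G then 0 else x)" if "x \<in> C" for x
    unfolding g_def using spoly_pair.construct_basis[OF C(3) that] by simp
  have gmod: "p - g p \<in> spoly.span G" if "p \<in> spoly.span C" for p
    using that
  proof (induction p rule: spoly.span_induct)
    case base
    show ?case
      by (rule spoly.subspaceI) (auto simp: g.zero g.add g.scale spoly.span_zero
        add_diff_add right_diff_distrib[symmetric] intro: spoly.span_add spoly.span_scale)
  next
    case (step x)
    then show ?case using gC[OF step] by (auto intro: spoly.span_base spoly.span_zero)
  qed
  define f where "f = (\<lambda>v. g (indet v))"
  have fmod: "indet v - f v \<in> ?P" if "v \<in> V" for v
    using gmod[of "indet v"] C(4) that GP unfolding f_def by blast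
  have fR: "f v \<in> carrier ?R" if "v \<in> V" for v
  proof -
    have "indet v \<in> carrier ?R" "- (indet v - f v) \<in> carrier ?R"
      using YV that fmod[OF that] PR spoly_carrier_closed(3) by blast+
    from spoly_carrier_closed(1)[OF this] show ?thesis by simp
  qed
  have lin': "Vector_Spaces.linear (\<lambda>(c::'k) p. cst c * p) (\<lambda>c p. cst c * p) (poly_at f)"
    by unfold_locales (simp_all add: poly_at_add poly_at_mult)
  have fG: "poly_at f p = 0" if "p \<in> G" for p
  proof -
    have "poly_at f p = g p"
    proof (rule spoly_pair.linear_eq_on[OF lin' lin])
      show "p \<in> spoly.span (indet ` V)" using that G by blast
      show "poly_at f b = g b" if "b \<in> indet ` V" for b
        using that by (auto simp: poly_at_Y f_def)
    qed
    then show ?thesis using gC[of p] that C(1) by auto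
  qed
  let ?K = "{p \<in> carrier ?R. poly_at f p = 0}"
  have K: "ideal ?K ?R"
  proof (rule idealI[OF R.ring_axioms])
    show "subgroup ?K (add_monoid ?R)"
    proof (rule R.add.subgroupI)
      show "?K \<subseteq> carrier ?R" "?K \<noteq> {}" by (auto intro: exI[of _ 0])
      fix a b assume a: "a \<in> ?K" and b: "b \<in> ?K"
      then show "a \<oplus>\<^bsub>?R\<^esub> b \<in> ?K" by (auto simp: poly_at_add spoly_carrier_closed)
      have "\<ominus>\<^bsub>?R\<^esub> a = - a"
        using a by (intro R.minus_equality) (auto simp: spoly_carrier_closed)
      moreover have "poly_at f (- a) = - poly_at f a" using poly_at_diff[of f 0 a] by simp
      ultimately show "\<ominus>\<^bsub>?R\<^esub> a \<in> ?K" using a by (auto simp: spoly_carrier_closed)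
    qed
  qed (auto simp: poly_at_mult spoly_carrier_closed)
  have "?P = ?K"
  proof
    show "?P \<subseteq> ?K" using R.genideal_minimal[OF K] fG GR by blast
    show "?K \<subseteq> ?P"
    proof
      fix p assume p: "p \<in> ?K"
      interpret P: ideal ?P ?R by (rule P)
      let ?h = "(+>\<^bsub>?R\<^esub>) ?P"
      have hom: "ring_hom_cring ?R (?R Quot ?P) ?h"
        by (rule P.rcos_ring_hom_cring) (rule R.is_cring)
      interpret h: ring_hom_cring ?R "?R Quot ?P" ?h by (rule hom)
      have V: "x \<in> V" if "m \<in> Poly_Mapping.keys p" "x \<in> Poly_Mapping.keys m" for m x
        using p that by (auto simp: spoly_carrier V_def svars_def)
      have eq: "?h (f v) = ?h (indet v)" if "v \<in> V" for v
        using spoly_coset_eq_iff[OF P, of "indet v" "f v"] fmod[OF that] fR[OF that] YV that by auto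
      have "?h p = ?h (poly_at indet p)" by (simp add: poly_at_Y_id)
      also have "\<dots> = ?h (poly_at f p)"
        by (rule hom_poly_at_cong[OF hom]) (use V subsetD[OF YV, OF imageI] fR eq in simp)
      finally have "?h p = ?h 0" using p by simp
      then show "p \<in> ?P" using spoly_coset_eq_iff[OF P, of p 0] p by simp
    qed
  qed
  moreover have "f v = indet v" if "v \<in> B" for v
  proof -
    have "indet v \<in> indet ` B" using that by simp
    then have "indet v \<in> C" "indet v \<notin> G" using C(1) disj by blast+
    then show ?thesis unfolding f_def using gC[of "indet v"] by simp
  qed
  ultimately show thesis using that[of f] fR unfolding V_def by blast
qed

text \<open>The kernel of a substitution is prime because its target is a domain.\<close>

lemma spoly_ideal_primeideal:
  fixes P :: "'k::field spoly set"
  assumes "ideal P (spoly_ring I)" "P = {p \<in> carrier (spoly_ring I). poly_at f p = 0}"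
  shows "primeideal P (spoly_ring I)"
proof (rule primeidealI)
  interpret R: domain "spoly_ring I :: 'k spoly ring" by (rule spoly_ring_domain)
  show "ideal P (spoly_ring I)" by fact
  show "cring (spoly_ring I :: 'k spoly ring)" by (rule R.is_cring)
  have "1 \<notin> P" using assms(2) by simp
  then show "carrier (spoly_ring I) \<noteq> P" using one_carrier by blast
  fix a b assume "a \<in> carrier (spoly_ring I)" "b \<in> carrier (spoly_ring I)"
    "a \<otimes>\<^bsub>spoly_ring I\<^esub> b \<in> P"
  then show "a \<in> P \<or> b \<in> P" using assms(2) by (auto simp: poly_at_mult)
qed

lemma sys_image_hom:
  assumes "prime_system \<alpha>1 \<alpha>2 I S"
  shows "field (sys_field \<alpha>1 \<alpha>2 I S)"
    and "ring_hom_cring (spoly_ring I) (sys_field \<alpha>1 \<alpha>2 I S) (sys_image \<alpha>1 \<alpha>2 I S)"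
    and "p \<in> carrier (spoly_ring I) \<Longrightarrow>
      sys_image \<alpha>1 \<alpha>2 I S p = \<zero>\<^bsub>sys_field \<alpha>1 \<alpha>2 I S\<^esub> \<longleftrightarrow> p \<in> sigma_ideal \<alpha>1 \<alpha>2 I S"
proof -
  let ?R = "spoly_ring I :: 'a spoly ring" and ?P = "sigma_ideal \<alpha>1 \<alpha>2 I S"
  let ?Q = "sys_ring \<alpha>1 \<alpha>2 I S" and ?L = "sys_field \<alpha>1 \<alpha>2 I S"
  interpret R: domain ?R by (rule spoly_ring_domain)
  interpret P: primeideal ?P ?R using assms by (simp add: prime_system_def)
  interpret Q: domain ?Q unfolding sys_ring_def by (rule P.quotient_is_domain)
  interpret L: field ?L unfolding sys_field_def by (rule Q.quot_field_field)
  show "field ?L" by (rule L.field_axioms)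
  have 1: "(+>\<^bsub>?R\<^esub>) ?P \<in> ring_hom ?R ?Q" unfolding sys_ring_def by (rule P.rcos_ring_hom)
  have "(\<lambda>a. fraction ?Q a \<one>\<^bsub>?Q\<^esub>) \<circ> ((+>\<^bsub>?R\<^esub>) ?P) \<in> ring_hom ?R ?L"
    unfolding sys_field_def by (rule ring_hom_trans[OF 1 Q.fraction_ring_hom])
  then have "sys_image \<alpha>1 \<alpha>2 I S \<in> ring_hom ?R ?L"
    unfolding sys_image_def comp_def .
  then show "ring_hom_cring ?R ?L (sys_image \<alpha>1 \<alpha>2 I S)"
    by (intro ring_hom_cring.intro ring_hom_cring_axioms.intro R.is_cring L.is_cring)
  assume p: "p \<in> carrier ?R"
  have "sys_image \<alpha>1 \<alpha>2 I S p = \<zero>\<^bsub>?L\<^esub> \<longleftrightarrow> ?P +>\<^bsub>?R\<^esub> p = \<zero>\<^bsub>?Q\<^esub>"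
    unfolding sys_image_def sys_field_def Q.quot_field_zero
    using ring_hom_closed[OF 1 p] by (simp add: Q.fraction_eq_iff)
  also have "\<zero>\<^bsub>?Q\<^esub> = ?P +>\<^bsub>?R\<^esub> 0"
    using ring_hom_zero[OF 1 R.ring_axioms Q.ring_axioms] by simp
  finally show "sys_image \<alpha>1 \<alpha>2 I S p = \<zero>\<^bsub>?L\<^esub> \<longleftrightarrow> p \<in> ?P"
    using spoly_coset_eq_iff[OF P.is_ideal p zero_carrier] by simp
qed

section \<open>Transcendence degrees of linear systems\<close>

text \<open>The field generated by the indeterminates with exponents in \<open>W\<close> is already generated by
  those in \<open>B\<close>, since all others are linear combinations modulo the system. Moreover \<open>B\<close> is
  algebraically independent modulo the system: a relation among its elements is a polynomial that
  is killed by the substitution of the elimination lemma and also fixed by it.\<close>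

theorem linear_system:
  fixes \<alpha>1 \<alpha>2 :: "'k::field_char_0 \<Rightarrow> 'k" and S :: "'k spoly set" and I :: "nat set"
  defines "G \<equiv> {gam_act \<alpha>1 \<alpha>2 \<gamma> A | \<gamma> A. A \<in> S}"
    and "L \<equiv> sys_field \<alpha>1 \<alpha>2 I S"
    and "\<iota> \<equiv> (\<lambda>c. sys_image \<alpha>1 \<alpha>2 I S (cst c))"
    and "\<eta> \<equiv> (\<lambda>\<gamma> i. sys_image \<alpha>1 \<alpha>2 I S (Y \<gamma> i))"
  assumes G: "G \<subseteq> spoly.span (indet ` svars I)" and B: "B \<subseteq> {v. fst v \<in> I \<and> snd v \<in> W}"
    and fin: "finite B"
    and ind: "spoly.independent (G \<union> indet ` B)" and disj: "G \<inter> indet ` B = {}"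
    and span: "\<And>v. fst v \<in> I \<Longrightarrow> snd v \<in> W \<Longrightarrow> indet v \<in> spoly.span (G \<union> indet ` B)"
  shows "prime_system \<alpha>1 \<alpha>2 I S"
    and "has_trdeg L \<iota> (generate_field L (range \<iota> \<union> {\<eta> \<gamma> i | \<gamma> i. \<gamma> \<in> W \<and> i \<in> I})) (card B)"
proof -
  let ?R = "spoly_ring I :: 'k spoly ring"
  interpret R: domain ?R by (rule spoly_ring_domain)
  have BV: "B \<subseteq> svars I" using B by (auto simp: svars_def)
  have Pdef: "sigma_ideal \<alpha>1 \<alpha>2 I S = genideal ?R G" by (simp add: sigma_ideal_def G_def)
  have YR: "indet v \<in> carrier ?R" if "fst v \<in> I" for v using that by (simp add: Y_carrier)
  have BY: "indet v \<in> carrier ?R" if "v \<in> B" for v using that B by (intro YR) blast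
  have GR: "G \<subseteq> carrier ?R"
  proof -
    have "spoly.span (indet ` svars I) \<subseteq> carrier ?R"
      using YR by (intro spoly_ideal_span[OF R.oneideal]) (auto simp: svars_def)
    then show ?thesis using G by simp
  qed
  have P: "ideal (sigma_ideal \<alpha>1 \<alpha>2 I S) ?R" unfolding Pdef using GR by (rule R.genideal_ideal)
  obtain f where f: "\<And>v. v \<in> svars I \<Longrightarrow> f v \<in> carrier ?R"
    "genideal ?R G = {p \<in> carrier ?R. poly_at f p = 0}"
    "\<And>v. v \<in> B \<Longrightarrow> f v = indet v"
    by (rule elimination[OF G BV ind disj]) (rule that; assumption)
  show prime: "prime_system \<alpha>1 \<alpha>2 I S"
    unfolding prime_system_def using spoly_ideal_primeideal[OF P] f(2) Pdef by simp
  define h where "h = sys_image \<alpha>1 \<alpha>2 I S"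
  interpret L: field L unfolding L_def by (rule sys_image_hom(1)[OF prime])
  have hom: "ring_hom_cring ?R L h"
    unfolding L_def h_def by (rule sys_image_hom(2)[OF prime])
  interpret h: ring_hom_cring ?R L h by (rule hom)
  have h0: "h p = \<zero>\<^bsub>L\<^esub> \<longleftrightarrow> poly_at f p = 0" if "p \<in> carrier ?R" for p
    using sys_image_hom(3)[OF prime that] that f(2) Pdef unfolding L_def h_def by simp
  have h_eta: "\<eta> \<gamma> i = h (indet (i, \<gamma>))" and h_iota: "\<iota> c = h (cst c)" for \<gamma> i c
    by (simp_all add: \<eta>_def \<iota>_def h_def)
  have iotaL: "range \<iota> \<subseteq> carrier L" by (auto simp: h_iota)
  have inj: "inj_on (\<lambda>v. h (indet v)) B"
  proof (rule inj_onI)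
    fix v w assume vw: "v \<in> B" "w \<in> B" "h (indet v) = h (indet w)"
    have carr: "indet v \<in> carrier ?R" "indet w \<in> carrier ?R" using vw BY by simp_all
    have "h (indet v - indet w) = h (indet v) \<ominus>\<^bsub>L\<^esub> h (indet w)"
      using carr h.hom_add h.hom_a_inv by (simp add: a_minus_def flip: spoly_ring_minus)
    also have "\<dots> = \<zero>\<^bsub>L\<^esub>" using vw(3) carr by (simp add: L.r_right_minus_eq)
    finally have "poly_at f (indet v - indet w) = 0"
      using h0[of "indet v - indet w"] carr spoly_ring_minus[OF carr] R.minus_closed[OF carr] by simp
    then have "indet v = (indet w :: 'k spoly)" using f(3) vw by (simp add: poly_at_diff poly_at_Y)
    then show "v = w" by (simp add: indet_inject)
  qed
  let ?B = "(\<lambda>v. h (indet v)) ` B"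
  let ?E = "generate_field L (range \<iota> \<union> {\<eta> \<gamma> i | \<gamma> i. \<gamma> \<in> W \<and> i \<in> I})"
  have BL: "?B \<subseteq> carrier L" using BY by auto
  let ?F = "generate_field L (range \<iota> \<union> ?B)"
  have FL: "range \<iota> \<union> ?B \<subseteq> carrier L" using iotaL BL by simp
  have F: "subfield ?F L" using FL by (rule L.generate_field_is_subfield)
  have "alg_independent L \<iota> ?B"
    unfolding alg_independent_def
  proof (intro conjI allI impI)
    show "?B \<subseteq> carrier L" by (rule BL)
    fix p assume keys: "\<forall>m\<in>Poly_Mapping.keys p. Poly_Mapping.keys m \<subseteq> ?B"
      and zero: "mpoly_value L \<iota> p = \<zero>\<^bsub>L\<^esub>"
    define g where "g = the_inv_into B (\<lambda>v. h (indet v))"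
    have gB: "g x \<in> B" and hg: "h (indet (g x)) = x" if "x \<in> ?B" for x
      using that the_inv_into_into[OF inj that] f_the_inv_into_f[OF inj that] by (auto simp: g_def)
    have gk: "g x \<in> B" "h (indet (g x)) = x"
      if "m \<in> Poly_Mapping.keys p" "x \<in> Poly_Mapping.keys m" for m x
      using that keys gB hg by blast+
    let ?Yg = "\<lambda>x. indet (g x) :: 'k spoly"
    have carr: "?Yg x \<in> carrier ?R" if "m \<in> Poly_Mapping.keys p" "x \<in> Poly_Mapping.keys m" for m x
      using gk(1)[OF that] BY by simp
    have q: "poly_at ?Yg p \<in> carrier ?R" using carr by (rule poly_at_carrier)
    have xL: "x \<in> carrier L" if "m \<in> Poly_Mapping.keys p" "x \<in> Poly_Mapping.keys m" for m x
      using keys that BL by blast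
    have "h (poly_at ?Yg p) = mpoly_value L \<iota> p"
      unfolding mpoly_value_def h_iota using carr gk(2) by (rule hom_poly_at[OF hom])
    then have "poly_at f (poly_at ?Yg p) = 0" using zero h0[OF q] by simp
    moreover have "poly_at f (poly_at ?Yg p) = poly_at ?Yg p"
      unfolding poly_at_poly_at using gk(1) by (intro poly_at_cong) (simp add: poly_at_Y f(3))
    ultimately have "poly_at ?Yg p = 0" by simp
    moreover have "inj_on g ?B" unfolding g_def by (rule inj_on_the_inv_into[OF inj])
    ultimately show "p = 0" using poly_at_renaming_eq_0[of g ?B p] keys by blast
  qed
  moreover have BE: "?B \<subseteq> ?E"
  proof
    fix x assume "x \<in> ?B"
    then obtain v where v: "v \<in> B" "x = \<eta> (snd v) (fst v)" by (auto simp: h_eta)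
    moreover have "fst v \<in> I" "snd v \<in> W" using v(1) B by auto
    ultimately show "x \<in> ?E" by (intro generate_field.incl) blast
  qed
  moreover have "?E \<subseteq> ?F"
  proof -
    have spanF: "h p \<in> ?F \<and> p \<in> carrier ?R" if "p \<in> spoly.span (G \<union> indet ` B)" for p
      using that
    proof (induction p rule: spoly.span_induct)
      case base
      show ?case
      proof (rule spoly.subspaceI)
        show "0 \<in> {p. h p \<in> ?F \<and> p \<in> carrier ?R}"
          using L.zero_in_generate h.hom_zero by simp
      next
        fix p q assume "p \<in> {p. h p \<in> ?F \<and> p \<in> carrier ?R}" "q \<in> {p. h p \<in> ?F \<and> p \<in> carrier ?R}"
        then show "p + q \<in> {p. h p \<in> ?F \<and> p \<in> carrier ?R}"
          using h.hom_add[of p q] by (auto simp: spoly_carrier_closed generate_field.eng_add)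
      next
        fix c p assume "p \<in> {p. h p \<in> ?F \<and> p \<in> carrier ?R}"
        moreover have "h (cst c) \<in> ?F" by (auto simp: h_iota intro!: generate_field.incl)
        ultimately show "cst c * p \<in> {p. h p \<in> ?F \<and> p \<in> carrier ?R}"
          using h.hom_mult[of "cst c" p] by (auto simp: spoly_carrier_closed generate_field.eng_mult)
      qed
    next
      case (step p)
      then show ?case
      proof
        assume p: "p \<in> G"
        then have "p \<in> genideal ?R G" using R.genideal_self[OF GR] by blast
        then have "h p = \<zero>\<^bsub>L\<^esub>" using h0[of p] f(2) by auto
        then show ?thesis using L.zero_in_generate p GR by auto
      next
        assume "p \<in> indet ` B"
        then show ?thesis using BY by (auto intro!: generate_field.incl)
      qed
    qed
    have "range \<iota> \<union> {\<eta> \<gamma> i | \<gamma> i. \<gamma> \<in> W \<and> i \<in> I} \<subseteq> ?F"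
      using spanF span by (fastforce simp: h_eta intro: generate_field.incl)
    then show ?thesis using F iotaL
      by (intro L.generate_field_min_subfield1) (auto simp: h_eta intro!: h.hom_closed YR Y_carrier)
  qed
  moreover have "(ring.algebraic L over ?F) x" if "x \<in> ?F" for x
    using L.algebraic_self[OF subfieldE(1)[OF F] that] .
  ultimately have "transcendence_basis L \<iota> ?E ?B" unfolding transcendence_basis_def by blast
  moreover have "card ?B = card B" using inj by (rule card_image)
  ultimately show "has_trdeg L \<iota> ?E (card B)" unfolding has_trdeg_def using fin by blast
qed

section \<open>Translates of linear forms\<close>

definition additive_inj :: "('k::field \<Rightarrow> 'k) \<Rightarrow> bool" where
  "additive_inj f \<longleftrightarrow> inj f \<and> (\<forall>x y. f (x + y) = f x + f y)"

lemma additive_inj_comp: "additive_inj f \<Longrightarrow> additive_inj g \<Longrightarrow> additive_inj (f \<circ> g)"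
  by (auto simp: additive_inj_def inj_compose)

lemma additive_inj_funpow: "additive_inj f \<Longrightarrow> additive_inj (f ^^ n)"
  by (induction n) (simp_all add: additive_inj_comp, simp add: additive_inj_def)

lemma additive_inj_gam_coeff:
  assumes "inversive_difference_field \<alpha>1 \<alpha>2"
  shows "additive_inj (gam_coeff \<alpha>1 \<alpha>2 \<gamma>)"
proof -
  have inv: "additive_inj f \<and> additive_inj (inv_into UNIV f)" if "field_automorphism f" for f :: "'a \<Rightarrow> 'a"
  proof -
    have bij: "bij f" and add: "f (x + y) = f x + f y" for x y
      using that by (auto simp: field_automorphism_def)
    have "inv_into UNIV f (x + y) = inv_into UNIV f x + inv_into UNIV f y" for x y
      using add[of "inv_into UNIV f x" "inv_into UNIV f y"] bij
      by (metis bij_inv_eq_iff)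
    then show ?thesis using bij add by (auto simp: additive_inj_def bij_is_inj bij_imp_bij_inv)
  qed
  then have "additive_inj (int_iter f n)" if "field_automorphism f" for f :: "'a \<Rightarrow> 'a" and n
    using that by (auto simp: int_iter_def additive_inj_funpow)
  then show ?thesis
    using assms by (auto simp: gam_coeff_def inversive_difference_field_def intro: additive_inj_comp)
qed

lemma additive_inj_zero: "additive_inj f \<Longrightarrow> f 0 = 0"
  unfolding additive_inj_def by (metis add_cancel_right_left)

lemma additive_inj_nonzero: "additive_inj f \<Longrightarrow> x \<noteq> 0 \<Longrightarrow> f x \<noteq> 0"
  using additive_inj_zero unfolding additive_inj_def by (metis injD)

lemma gam_act_superset:
  assumes "additive_inj (gam_coeff \<alpha>1 \<alpha>2 \<gamma>)" "finite M" "Poly_Mapping.keys p \<subseteq> M"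
  shows "gam_act \<alpha>1 \<alpha>2 \<gamma> p = (\<Sum>m\<in>M.
     Poly_Mapping.single (gam_monom \<gamma> m) (gam_coeff \<alpha>1 \<alpha>2 \<gamma> (Poly_Mapping.lookup p m)))"
  unfolding gam_act_def using assms
  by (intro sum.mono_neutral_left) (auto simp: in_keys_iff additive_inj_zero)

lemma gam_act_add:
  assumes "additive_inj (gam_coeff \<alpha>1 \<alpha>2 \<gamma>)"
  shows "gam_act \<alpha>1 \<alpha>2 \<gamma> (p + q) = gam_act \<alpha>1 \<alpha>2 \<gamma> p + gam_act \<alpha>1 \<alpha>2 \<gamma> q"
proof -
  let ?M = "Poly_Mapping.keys p \<union> Poly_Mapping.keys q"
  have "gam_act \<alpha>1 \<alpha>2 \<gamma> (p + q) = (\<Sum>m\<in>?M.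
     Poly_Mapping.single (gam_monom \<gamma> m) (gam_coeff \<alpha>1 \<alpha>2 \<gamma> (Poly_Mapping.lookup (p + q) m)))"
    by (rule gam_act_superset[OF assms]) (auto dest: subsetD[OF keys_add])
  also have "\<dots> = gam_act \<alpha>1 \<alpha>2 \<gamma> p + gam_act \<alpha>1 \<alpha>2 \<gamma> q"
    using assms by (simp add: gam_act_superset[OF assms, of ?M] lookup_add additive_inj_def single_add
      sum.distrib)
  finally show ?thesis .
qed

lemma gam_act_sum:
  assumes "additive_inj (gam_coeff \<alpha>1 \<alpha>2 \<gamma>)"
  shows "gam_act \<alpha>1 \<alpha>2 \<gamma> (sum p M) = (\<Sum>x\<in>M. gam_act \<alpha>1 \<alpha>2 \<gamma> (p x))"
  by (induction M rule: infinite_finite_induct)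
    (simp_all add: gam_act_add[OF assms], simp_all add: gam_act_def)

lemma gam_act_cst_Y:
  assumes "additive_inj (gam_coeff \<alpha>1 \<alpha>2 \<gamma>)"
  shows "gam_act \<alpha>1 \<alpha>2 \<gamma> (cst c * Y v i) = cst (gam_coeff \<alpha>1 \<alpha>2 \<gamma> c) * Y (\<gamma> + v) i"
  unfolding cst_Y by (simp add: gam_act_def gam_monom_def additive_inj_zero[OF assms])

text \<open>Linear independence of linear forms is tested by reading off single coefficients.\<close>

definition lin_coeff :: "svar \<Rightarrow> 'k::field spoly \<Rightarrow> 'k" where
  "lin_coeff v p = Poly_Mapping.lookup p (Poly_Mapping.single v 1)"

lemma lin_coeff_add: "lin_coeff v (p + q) = lin_coeff v p + lin_coeff v q"
  and lin_coeff_zero [simp]: "lin_coeff v 0 = 0"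
  and lin_coeff_sum: "lin_coeff v (sum f M) = (\<Sum>x\<in>M. lin_coeff v (f x))"
  by (simp_all add: lin_coeff_def lookup_add lookup_sum)

lemma lin_coeff_scale: "lin_coeff v (cst c * p) = c * lin_coeff v p"
  unfolding lin_coeff_def cst_def mult_map_scale_conv_mult[symmetric]
  by (simp add: Poly_Mapping.map.rep_eq when_def)

lemma lin_coeff_Y: "lin_coeff v (Y \<gamma> i) = (if v = (i, \<gamma>) then 1 else 0)"
proof -
  have "Poly_Mapping.single (i, \<gamma>) (1::nat) = Poly_Mapping.single v 1 \<longleftrightarrow> v = (i, \<gamma>)"
  proof
    assume "Poly_Mapping.single (i, \<gamma>) (1::nat) = Poly_Mapping.single v 1"
    then have "Poly_Mapping.keys (Poly_Mapping.single (i, \<gamma>) (1::nat))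
        = Poly_Mapping.keys (Poly_Mapping.single v (1::nat))" by simp
    then show "v = (i, \<gamma>)" by simp
  qed simp
  then show ?thesis by (simp add: lin_coeff_def Y_def lookup_single when_def)
qed

text \<open>Stated for indexed families so that the disjointness of the two images is a consequence
  of the absence of linear relations.\<close>

lemma (in vector_space) independent_union_of_families:
  assumes fam: "\<And>M N c b. finite M \<Longrightarrow> M \<subseteq> P \<Longrightarrow> finite N \<Longrightarrow> N \<subseteq> Q \<Longrightarrow>
    (\<Sum>x\<in>M. scale (c x) (f x)) + (\<Sum>z\<in>N. scale (b z) (g z)) = 0 \<Longrightarrow>
    (\<forall>x\<in>M. c x = 0) \<and> (\<forall>z\<in>N. b z = 0)"
  shows "independent (f ` P \<union> g ` Q)" and "f ` P \<inter> g ` Q = {}"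
proof -
  show "independent (f ` P \<union> g ` Q)"
    unfolding independent_explicit_module
  proof (intro allI impI)
    fix t u v assume t: "finite t" "t \<subseteq> f ` P \<union> g ` Q" "(\<Sum>v\<in>t. scale (u v) v) = 0" "v \<in> t"
    obtain M where M: "M \<subseteq> P" "inj_on f M" "t \<inter> f ` P = f ` M"
      using subset_image_inj[of "t \<inter> f ` P" f P] by blast
    have "t - f ` P \<subseteq> g ` Q" using t(2) by blast
    then obtain N where N: "N \<subseteq> Q" "inj_on g N" "t - f ` P = g ` N"
      using subset_image_inj[of "t - f ` P" g Q] by blast
    have fin: "finite M" "finite N"
      using t(1) M N by (metis finite_Int finite_imageD, metis finite_Diff finite_imageD)
    have "(\<Sum>v\<in>t. scale (u v) v) = (\<Sum>v\<in>f ` M. scale (u v) v) + (\<Sum>v\<in>g ` N. scale (u v) v)"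
      unfolding M(3)[symmetric] N(3)[symmetric] using t(1) by (subst sum.Int_Diff[of t _ "f ` P"]) auto
    also have "\<dots> = (\<Sum>x\<in>M. scale (u (f x)) (f x)) + (\<Sum>z\<in>N. scale (u (g z)) (g z))"
      using M N by (simp add: sum.reindex)
    finally have "(\<Sum>x\<in>M. scale (u (f x)) (f x)) + (\<Sum>z\<in>N. scale (u (g z)) (g z)) = 0"
      using t(3) by metis
    then have "(\<forall>x\<in>M. u (f x) = 0) \<and> (\<forall>z\<in>N. u (g z) = 0)"
      by (rule fam[OF fin(1) M(1) fin(2) N(1)])
    moreover have "v \<in> f ` M \<or> v \<in> g ` N" using t(4) unfolding M(3)[symmetric] N(3)[symmetric] by simp
    ultimately show "u v = 0" by fast
  qed
  show "f ` P \<inter> g ` Q = {}"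
  proof (rule ccontr)
    assume "f ` P \<inter> g ` Q \<noteq> {}"
    then obtain x z where "x \<in> P" "z \<in> Q" "f x = g z" by blast
    then show False using fam[of "{x}" "{z}" "\<lambda>_. 1" "\<lambda>_. - 1"] by simp
  qed
qed

section \<open>Linear difference schemes\<close>

lemma finite_Gam [simp]: "finite (Gam r)"
proof (rule finite_subset)
  show "Gam r \<subseteq> {- r..r} \<times> {- r..r}" by (auto simp: Gam_def ord_gam_def)
qed simp

text \<open>The ball is cut out by four half-planes; the four directions are treated uniformly below.\<close>

lemma Gam_iff: "\<gamma> \<in> Gam r \<longleftrightarrow>
    (\<forall>s\<in>{- 1, 1}. \<forall>t\<in>{- 1, 1}. s * fst \<gamma> + t * snd \<gamma> \<le> r)"
  by (auto simp: Gam_def ord_gam_def)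

text \<open>Equations of the form \<open>A\<^sub>i = \<Sum> w\<^sub>i(e, v) v y\<close>, where the sum runs over \<open>(e, v) \<in> T\<close> and
  \<open>y\<close> has index \<open>2 i - e\<close>. The assumption \<open>corner\<close> says that in each of the four diagonal
  directions the highest level of the equation is reached by one of its two indeterminates at a
  single exponent, with nonzero coefficient; the other indeterminate may reach it as well. The assumption \<open>top\<close> provides a leader, the term
  \<open>\<alpha>2 y\<close> with index \<open>2 i\<close>, by which each translate of the equation is solved.\<close>

locale difference_scheme =
  fixes \<alpha>1 \<alpha>2 :: "'k::field_char_0 \<Rightarrow> 'k"
    and J :: "nat set" and T :: "(nat \<times> gam) set" and w :: "nat \<Rightarrow> nat \<times> gam \<Rightarrow> 'k"
  assumes idf: "inversive_difference_field \<alpha>1 \<alpha>2"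
    and fin_J: "finite J" and J_pos: "i \<in> J \<Longrightarrow> 1 \<le> i"
    and fin_T: "finite T" and T_comp: "(e, v) \<in> T \<Longrightarrow> e \<le> 1"
    and corner: "s \<in> {- 1, 1} \<Longrightarrow> t \<in> {- 1, 1} \<Longrightarrow> \<exists>e v. (e, v) \<in> T \<and> (\<forall>i\<in>J. w i (e, v) \<noteq> 0) \<and>
       (\<forall>(e', v')\<in>T. s * fst v' + t * snd v' \<le> s * fst v + t * snd v \<and>
          (e' = e \<longrightarrow> s * fst v' + t * snd v' = s * fst v + t * snd v \<longrightarrow> v' = v))"
    and top: "(0, (0, 1)) \<in> T" "i \<in> J \<Longrightarrow> w i (0, (0, 1)) \<noteq> 0"
       "(0, v) \<in> T \<Longrightarrow> v = (0, 1) \<or> snd v < 1"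
begin

definition scheme_eq :: "nat \<Rightarrow> 'k spoly" where
  "scheme_eq i = (\<Sum>(e, v)\<in>T. cst (w i (e, v)) * Y v (2 * i - e))"

definition inds :: "nat set" where
  "inds = (\<Union>i\<in>J. {2 * i - 1, 2 * i})"

definition inner :: "int \<Rightarrow> gam set" where
  "inner r = {\<gamma>. \<forall>(e, v)\<in>T. \<gamma> + v \<in> Gam r}"

definition leaders :: "int \<Rightarrow> svar set" where
  "leaders r = (\<lambda>(i, \<gamma>). (2 * i, \<gamma> + (0, 1))) ` (J \<times> inner r)"

text \<open>Solving the translates of the equations that lie in the ball for their leaders leaves these
  indeterminates as parameters; they give the transcendence basis.\<close>

definition free_vars :: "int \<Rightarrow> svar set" where
  "free_vars r = {v. fst v \<in> inds \<and> snd v \<in> Gam r} - leaders r"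

abbreviation act :: "gam \<Rightarrow> 'k spoly \<Rightarrow> 'k spoly" where "act \<equiv> gam_act \<alpha>1 \<alpha>2"
abbreviation co :: "gam \<Rightarrow> 'k \<Rightarrow> 'k" where "co \<equiv> gam_coeff \<alpha>1 \<alpha>2"

lemma co_additive_inj: "additive_inj (co \<gamma>)"
  by (rule additive_inj_gam_coeff[OF idf])

lemma act_scheme_eq: "act \<gamma> (scheme_eq i) = (\<Sum>(e, v)\<in>T. cst (co \<gamma> (w i (e, v))) * Y (\<gamma> + v) (2 * i - e))"
  unfolding scheme_eq_def gam_act_sum[OF co_additive_inj]
  by (intro sum.cong) (auto simp: gam_act_cst_Y[OF co_additive_inj])

lemma index_inject:
  assumes "i \<in> J" "j \<in> J" "e \<le> 1" "d \<le> 1"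
  shows "2 * i - e = 2 * j - d \<longleftrightarrow> i = j \<and> e = d"
proof -
  have "e = 0 \<or> e = 1" "d = 0 \<or> d = 1" using assms(3,4) by auto
  then show ?thesis using J_pos[OF assms(1)] J_pos[OF assms(2)] by (elim disjE) (simp; arith)+
qed

lemma lin_coeff_act_scheme_eq:
  assumes "i \<in> J" "j \<in> J" "e \<le> 1"
  shows "lin_coeff (2 * i - e, \<delta>) (act \<gamma> (scheme_eq j))
    = (if i = j \<and> (e, \<delta> - \<gamma>) \<in> T then co \<gamma> (w i (e, \<delta> - \<gamma>)) else 0)"
proof -
  have "lin_coeff (2 * i - e, \<delta>) (act \<gamma> (scheme_eq j)) = (\<Sum>x\<in>T.
      if i = j \<and> x = (e, \<delta> - \<gamma>) then co \<gamma> (w i (e, \<delta> - \<gamma>)) else 0)"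
    unfolding act_scheme_eq lin_coeff_sum
  proof (rule sum.cong[OF refl])
    fix x assume x: "x \<in> T"
    obtain d v where dv: "x = (d, v)" by (cases x)
    have "\<delta> = \<gamma> + v \<longleftrightarrow> v = \<delta> - \<gamma>" by (auto simp: algebra_simps)
    then show "lin_coeff (2 * i - e, \<delta>) (case x of (d, v) \<Rightarrow> cst (co \<gamma> (w j (d, v))) * Y (\<gamma> + v) (2 * j - d))
       = (if i = j \<and> x = (e, \<delta> - \<gamma>) then co \<gamma> (w i (e, \<delta> - \<gamma>)) else 0)"
      using index_inject[OF assms, of d] T_comp x dv by (auto simp: lin_coeff_scale lin_coeff_Y)
  qed
  then show ?thesis using fin_T by (cases "i = j") auto
qed

text \<open>A direction is given by the additive functional \<open>s i + t j\<close>. Among the translations that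
  occur in a combination of translated equations choose a highest one. Its product with the unique
  highest exponent \<open>v\<close> of the equation arises in no other way, so this term cannot cancel inside the
  combination and must be matched by an indeterminate from \<open>N\<close>. Coefficients are only acted on
  by automorphisms and stay nonzero.\<close>

lemma relation_corner:
  assumes M: "finite M" "M \<subseteq> J \<times> UNIV" and N: "finite N"
    and zero: "(\<Sum>x\<in>M. cst (c x) * act (snd x) (scheme_eq (fst x))) + (\<Sum>v\<in>N. cst (b v) * indet v) = 0"
    and x: "x \<in> M" "c x \<noteq> 0"
    and ev: "(e, v) \<in> T" "w (fst x) (e, v) \<noteq> 0"
    and max: "\<And>v'. (e, v') \<in> T \<Longrightarrow> v' = v \<or> s * fst v' + t * snd v' < s * fst v + t * snd v"
  obtains \<gamma> where "(fst x, \<gamma>) \<in> M" "c (fst x, \<gamma>) \<noteq> 0"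
    "s * fst (snd x) + t * snd (snd x) \<le> s * fst \<gamma> + t * snd \<gamma>" "(2 * fst x - e, \<gamma> + v) \<in> N"
proof -
  define i where "i = fst x"
  define l where "l = (\<lambda>\<gamma>::gam. s * fst \<gamma> + t * snd \<gamma>)"
  let ?D = "{\<gamma>. (i, \<gamma>) \<in> M \<and> c (i, \<gamma>) \<noteq> 0}"
  have "finite ?D" by (rule finite_subset[of _ "snd ` M"]) (use M in force)+
  moreover have "snd x \<in> ?D" using x by (simp add: i_def)
  ultimately obtain \<gamma> where g: "\<gamma> \<in> ?D" "\<And>\<beta>. \<beta> \<in> ?D \<Longrightarrow> l \<beta> \<le> l \<gamma>"
  proof -
    assume fin: "finite ?D" and "snd x \<in> ?D"
    then have "Max (l ` ?D) \<in> l ` ?D" by (intro Max_in finite_imageI) blast+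
    then obtain \<gamma> where "\<gamma> \<in> ?D" "l \<gamma> = Max (l ` ?D)" by auto
    then show thesis using that[of \<gamma>] fin by simp
  qed
  have iJ: "i \<in> J" and e: "e \<le> 1" using M x ev T_comp by (auto simp: i_def)
  let ?u = "(2 * i - e, \<gamma> + v)"
  have summand: "c y * lin_coeff ?u (act (snd y) (scheme_eq (fst y)))
      = (if y = (i, \<gamma>) then c y * co \<gamma> (w i (e, v)) else 0)" if y: "y \<in> M" for y
  proof (cases "c y \<noteq> 0 \<and> fst y = i \<and> (e, \<gamma> + v - snd y) \<in> T")
    case True
    then have "snd y \<in> ?D" using y by auto
    then have "l (snd y) \<le> l \<gamma>" using g(2) by simp
    moreover have "l (\<gamma> + v - snd y) = l \<gamma> + l v - l (snd y)" by (simp add: l_def algebra_simps)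
    moreover have "\<gamma> + v - snd y = v \<or> l (\<gamma> + v - snd y) < l v"
      using max True unfolding l_def by blast
    ultimately have "\<gamma> + v - snd y = v" by linarith
    then have "y = (i, \<gamma>)" using True by (auto simp: prod_eq_iff)
    then show ?thesis using lin_coeff_act_scheme_eq[OF iJ iJ e, of "\<gamma> + v" \<gamma>] ev(1) by simp
  next
    case False
    have "fst y \<in> J" using y M by auto
    have "c y = 0 \<or> lin_coeff ?u (act (snd y) (scheme_eq (fst y))) = 0"
      using False lin_coeff_act_scheme_eq[OF iJ \<open>fst y \<in> J\<close> e, of "\<gamma> + v" "snd y"] by auto
    moreover have "y \<noteq> (i, \<gamma>)" using False g(1) ev(1) by auto
    ultimately show ?thesis by auto
  qed
  have "0 = lin_coeff ?u ((\<Sum>x\<in>M. cst (c x) * act (snd x) (scheme_eq (fst x))) + (\<Sum>v\<in>N. cst (b v) * indet v))"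
    by (simp add: zero)
  also have "\<dots> = (\<Sum>y\<in>M. if y = (i, \<gamma>) then c y * co \<gamma> (w i (e, v)) else 0)
      + (\<Sum>y\<in>N. if y = ?u then b y else 0)"
    unfolding lin_coeff_add lin_coeff_sum lin_coeff_scale using summand
    by (intro arg_cong2[of _ _ _ _ "(+)"] sum.cong) (auto simp: lin_coeff_Y)
  also have "\<dots> = c (i, \<gamma>) * co \<gamma> (w i (e, v)) + (if ?u \<in> N then b ?u else 0)"
    using M N g(1) by simp
  finally have "?u \<in> N"
    using g(1) additive_inj_nonzero[OF co_additive_inj ev(2)] by (auto simp: i_def split: if_splits)
  then show thesis using that[of \<gamma>] g \<open>snd x \<in> ?D\<close> by (auto simp: i_def l_def)
qed

text \<open>The four diagonal directions confine all occurring translations to \<open>inner r\<close>, because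
  the surviving extreme terms must lie in the ball. The direction of the second coordinate then yields
  a leader of an equation in \<open>inner r\<close> that does not cancel, and no leader belongs to the free
  indeterminates.\<close>

lemma relation_trivial:
  assumes M: "finite M" "M \<subseteq> J \<times> UNIV" and N: "finite N" "N \<subseteq> free_vars r"
    and zero: "(\<Sum>x\<in>M. cst (c x) * act (snd x) (scheme_eq (fst x))) + (\<Sum>v\<in>N. cst (b v) * indet v) = 0"
  shows "(\<forall>x\<in>M. c x = 0) \<and> (\<forall>v\<in>N. b v = 0)"
proof -
  have N_free: "v \<in> free_vars r" if "v \<in> N" for v using that N by blast
  have inner: "snd x \<in> inner r" if x: "x \<in> M" "c x \<noteq> 0" for x
  proof -
    have iJ: "fst x \<in> J" using x M by auto
    have "s * fst (snd x + v') + t * snd (snd x + v') \<le> r"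
      if st: "s \<in> {- 1, 1}" "t \<in> {- 1, 1}" and v': "(e', v') \<in> T" for s t e' v'
    proof -
      obtain e v where ev: "(e, v) \<in> T" "\<forall>i\<in>J. w i (e, v) \<noteq> 0"
        and max: "\<forall>(e', v')\<in>T. s * fst v' + t * snd v' \<le> s * fst v + t * snd v \<and>
          (e' = e \<longrightarrow> s * fst v' + t * snd v' = s * fst v + t * snd v \<longrightarrow> v' = v)"
        using corner[OF st] by blast
      have max': "v' = v \<or> s * fst v' + t * snd v' < s * fst v + t * snd v" if "(e, v') \<in> T" for v'
        using bspec[OF max that] by auto
      obtain \<gamma> where g: "s * fst (snd x) + t * snd (snd x) \<le> s * fst \<gamma> + t * snd \<gamma>"
        "(2 * fst x - e, \<gamma> + v) \<in> N"
        using relation_corner[OF M N(1) zero x ev(1) _ max'] ev(2) iJ by blast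
      then have "\<gamma> + v \<in> Gam r" using N_free[OF g(2)] by (simp add: free_vars_def)
      then have "s * fst (\<gamma> + v) + t * snd (\<gamma> + v) \<le> r" using st unfolding Gam_iff by blast
      moreover have "s * fst v' + t * snd v' \<le> s * fst v + t * snd v" using bspec[OF max v'] by simp
      ultimately show ?thesis using g(1) by (simp add: algebra_simps)
    qed
    then show ?thesis unfolding inner_def Gam_iff by blast
  qed
  have c0: "c x = 0" if x: "x \<in> M" for x
  proof (rule ccontr)
    assume nz: "c x \<noteq> 0"
    have iJ: "fst x \<in> J" using x M by auto
    have max: "v' = (0, 1) \<or> 0 * fst v' + 1 * snd v' < 0 * fst (0::int, 1::int) + 1 * snd (0::int, 1::int)"
      if "(0, v') \<in> T" for v' using top(3)[OF that] by simp
    obtain \<gamma> where g: "(fst x, \<gamma>) \<in> M" "c (fst x, \<gamma>) \<noteq> 0" "(2 * fst x - 0, \<gamma> + (0, 1)) \<in> N"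
      using relation_corner[OF M N(1) zero x nz top(1) top(2)[OF iJ] max] by metis
    have "\<gamma> \<in> inner r" using inner[OF g(1,2)] by simp
    then have "(2 * fst x, \<gamma> + (0, 1)) \<in> leaders r" using iJ by (force simp: leaders_def)
    then show False using N_free[OF g(3)] by (simp add: free_vars_def)
  qed
  moreover have "b u = 0" if u: "u \<in> N" for u
  proof -
    have "0 = lin_coeff u (\<Sum>v\<in>N. cst (b v) * indet v)" using zero c0 by simp
    also have "\<dots> = (\<Sum>y\<in>N. if y = u then b y else 0)"
      unfolding lin_coeff_sum lin_coeff_scale by (intro sum.cong) (auto simp: lin_coeff_Y)
    finally show ?thesis using u N by simp
  qed
  ultimately show ?thesis by blast
qed

text \<open>Each leader is a combination of free indeterminates with index \<open>2 i - 1\<close> and of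
  indeterminates with index \<open>2 i\<close> that are strictly lower in the second coordinate, all inside the
  ball; this allows an induction on the second coordinate.\<close>

lemma free_vars_span:
  assumes "fst v \<in> inds" "snd v \<in> Gam r"
  shows "indet v \<in> spoly.span ({act \<gamma> p | \<gamma> p. p \<in> scheme_eq ` J} \<union> indet ` free_vars r)" (is "_ \<in> spoly.span ?S")
  using assms
proof (induction "nat (snd (snd v) + r)" arbitrary: v rule: less_induct)
  case less
  show ?case
  proof (cases "v \<in> free_vars r")
    case True
    then show ?thesis by (intro spoly.span_base) blast
  next
    case False
    then have "v \<in> leaders r" using less.prems by (simp add: free_vars_def)
    then obtain i \<gamma> where v: "v = (2 * i, \<gamma> + (0, 1))" "i \<in> J" "\<gamma> \<in> inner r"
      by (auto simp: leaders_def)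
    let ?t = "\<lambda>x. case x of (e, v) \<Rightarrow> cst (co \<gamma> (w i (e, v))) * Y (\<gamma> + v) (2 * i - e)"
    have rest: "?t x \<in> spoly.span ?S" if x: "x \<in> T - {(0, (0, 1))}" for x
    proof -
      obtain e u where eu: "x = (e, u)" by (cases x)
      have e: "e = 0 \<or> e = 1" and G: "\<gamma> + u \<in> Gam r"
        using T_comp[of e u] x eu v(3) by (auto simp: inner_def)
      have I: "2 * i - e \<in> inds" using e v(2) by (auto simp: inds_def)
      have "indet (2 * i - e, \<gamma> + u) \<in> spoly.span ?S"
        using e
      proof
        assume e0: "e = 0"
        then have "snd u < 1" using top(3)[of u] x eu by auto
        moreover have "- r \<le> snd (\<gamma> + u)" using G by (auto simp: Gam_def ord_gam_def)
        ultimately have "nat (snd (\<gamma> + u) + r) < nat (snd (snd v) + r)" using v(1) by simp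
        then show ?thesis using I G by (intro less.hyps) auto
      next
        assume e1: "e = 1"
        have "2 * i - 1 \<noteq> 2 * j" for j using J_pos[OF v(2)] by presburger
        then have "(2 * i - 1, \<gamma> + u) \<in> free_vars r"
          using I G e1 by (auto simp: free_vars_def leaders_def)
        then show ?thesis unfolding e1 by (intro spoly.span_base) blast
      qed
      then show ?thesis using spoly.span_scale[of _ ?S "co \<gamma> (w i (e, u))"] by (simp add: eu)
    qed
    have "act \<gamma> (scheme_eq i) = ?t (0, (0, 1)) + sum ?t (T - {(0, (0, 1))})"
      unfolding act_scheme_eq using fin_T top(1) by (rule sum.remove)
    then have "cst (co \<gamma> (w i (0, (0, 1)))) * indet v = act \<gamma> (scheme_eq i) - sum ?t (T - {(0, (0, 1))})"
      by (simp add: v(1))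
    moreover have "act \<gamma> (scheme_eq i) \<in> spoly.span ?S" using v(2) by (intro spoly.span_base) blast
    ultimately have "cst (co \<gamma> (w i (0, (0, 1)))) * indet v \<in> spoly.span ?S"
      using rest by (auto intro!: spoly.span_diff spoly.span_sum)
    from spoly.span_scale[OF this, of "inverse (co \<gamma> (w i (0, (0, 1))))"]
    have "cst (inverse (co \<gamma> (w i (0, (0, 1)))) * co \<gamma> (w i (0, (0, 1)))) * indet v \<in> spoly.span ?S"
      by (simp only: cst_mult mult.assoc)
    moreover have "inverse (co \<gamma> (w i (0, (0, 1)))) * co \<gamma> (w i (0, (0, 1))) = 1"
      using additive_inj_nonzero[OF co_additive_inj top(2)[OF v(2)]] by (rule left_inverse)
    ultimately show ?thesis by (simp only: cst_one mult_1_left)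
  qed
qed

lemma inner_subset: "\<gamma> \<in> inner r \<Longrightarrow> \<gamma> + (0, 1) \<in> Gam r"
  using top(1) by (auto simp: inner_def)

lemma card_free_vars:
  "finite (free_vars r)" "card (free_vars r) + card J * card (inner r) = card J * (2 * card (Gam r))"
proof -
  let ?V = "{v. fst v \<in> inds \<and> snd v \<in> Gam r}"
  have V: "?V = (\<lambda>(i, e, \<gamma>). (2 * i - e, \<gamma>)) ` (J \<times> {0, 1} \<times> Gam r)" (is "_ = ?f ` ?X")
    by (force simp: inds_def)
  have "inj_on ?f ?X"
    by (rule inj_onI) (auto simp: index_inject dest: index_inject[THEN iffD1, rotated -1])
  then have card_V: "card ?V = card J * (2 * card (Gam r))"
    unfolding V by (simp add: card_image card_cartesian_product)
  have fin_V: "finite ?V" unfolding V using fin_J by simp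
  have sub: "leaders r \<subseteq> ?V" using inner_subset by (auto simp: leaders_def inds_def)
  have "card (leaders r) = card J * card (inner r)"
    unfolding leaders_def by (subst card_image) (auto simp: inj_on_def card_cartesian_product)
  then show "card (free_vars r) + card J * card (inner r) = card J * (2 * card (Gam r))"
    unfolding free_vars_def
    using card_V card_Diff_subset[OF finite_subset[OF sub fin_V] sub] card_mono[OF fin_V sub] by linarith
  show "finite (free_vars r)" using fin_V by (simp add: free_vars_def)
qed

text \<open>The number of relations among the indeterminates in the ball of radius \<open>r\<close> is the number
  of translated equations lying in that ball.\<close>

theorem sigma_dim_poly_scheme:
  assumes "\<forall>\<^sub>F r in at_top. poly \<psi> (of_int r) =
     of_nat (card J) * (2 * of_nat (card (Gam r)) - of_nat (card (inner r)))"
  shows "sigma_dim_poly \<alpha>1 \<alpha>2 inds (scheme_eq ` J) \<psi>"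
proof -
  let ?G = "{act \<gamma> p | \<gamma> p. p \<in> scheme_eq ` J}"
  have G: "?G = (\<lambda>x. act (snd x) (scheme_eq (fst x))) ` (J \<times> UNIV)" by force
  have G_span: "?G \<subseteq> spoly.span (indet ` svars inds)"
  proof -
    have "act \<gamma> (scheme_eq i) \<in> spoly.span (indet ` svars inds)" if i: "i \<in> J" for i \<gamma>
      unfolding act_scheme_eq
    proof (rule spoly.span_sum, clarify)
      fix e v1 v2 assume "(e, v1, v2) \<in> T"
      then have "e = 0 \<or> e = 1" using T_comp by force
      then have "2 * i - e \<in> inds" using i by (auto simp: inds_def)
      then have "(2 * i - e, \<gamma> + (v1, v2)) \<in> svars inds" by (simp add: svars_def)
      from imageI[OF this, of indet] have "Y (\<gamma> + (v1, v2)) (2 * i - e) \<in> indet ` svars inds" by simp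
      then show "cst (co \<gamma> (w i (e, v1, v2))) * Y (\<gamma> + (v1, v2)) (2 * i - e)
        \<in> spoly.span (indet ` svars inds)"
        by (intro spoly.span_scale spoly.span_base) simp
    qed
    then show ?thesis by blast
  qed

  have ind: "spoly.independent (?G \<union> indet ` free_vars r)" "?G \<inter> indet ` free_vars r = {}" for r
    unfolding G by (rule spoly.independent_union_of_families, rule relation_trivial; assumption)+
  have free: "free_vars r \<subseteq> {v. fst v \<in> inds \<and> snd v \<in> Gam r}" for r by (auto simp: free_vars_def)
  note lin = linear_system[OF G_span free card_free_vars(1) ind free_vars_span]
  have "of_nat (card (free_vars r)) =
      (of_nat (card J) * (2 * of_nat (card (Gam r)) - of_nat (card (inner r))) :: rat)" for r
    using arg_cong[OF card_free_vars(2)[of r], of "of_nat :: nat \<Rightarrow> rat"] by (simp add: algebra_simps)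
  then have "\<forall>\<^sub>F r in at_top. poly \<psi> (of_int r) = of_nat (card (free_vars r))"
    using assms by simp
  note ev = this
  show ?thesis
    unfolding sigma_dim_poly_def Let_def
  proof (intro conjI)
    show "prime_system \<alpha>1 \<alpha>2 inds (scheme_eq ` J)" by (rule lin(1))
  qed (rule eventually_mono[OF ev], rule exI, rule conjI, rule lin(2), assumption+)
qed

end

section \<open>Counting lattice points\<close>

lemma card_Gam:
  assumes "0 \<le> r"
  shows "int (card (Gam r)) = 2 * r^2 + 2 * r + 1"
proof -
  have "Gam r = Sigma {- r..r} (\<lambda>i. {- (r - \<bar>i\<bar>)..r - \<bar>i\<bar>})"
    by (auto simp: Gam_def ord_gam_def)
  then have "int (card (Gam r)) = (\<Sum>i\<in>{- r..r}. int (card {- (r - \<bar>i\<bar>)..r - \<bar>i\<bar>}))"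
    by simp
  also have "\<dots> = (\<Sum>i\<in>{- r..r}. 2 * (r - \<bar>i\<bar>) + 1)"
    by (intro sum.cong) auto
  \<comment> \<open>the summation range is decoupled from \<open>r\<close> to permit induction\<close>
  also have "(\<Sum>i\<in>{- int m..int m}. 2 * (r - \<bar>i\<bar>) + 1) = (2 * m + 1) * (2 * r + 1) - 2 * m * (m + 1)" for m
  proof (induction m)
    case (Suc m)
    have "{- int (Suc m)..int (Suc m)} = insert (- int (Suc m)) (insert (int (Suc m)) {- int m..int m})"
      by auto
    then show ?case using Suc by (simp add: algebra_simps)
  qed simp
  from this[of "nat r"] have "(\<Sum>i\<in>{- r..r}. 2 * (r - \<bar>i\<bar>) + 1) = 2 * r^2 + 2 * r + 1"
    using assms by (simp add: algebra_simps power2_eq_square)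
  finally show ?thesis .
qed

section \<open>The forward and the symmetric scheme\<close>

definition forward_supp :: "(nat \<times> gam) set" where
  "forward_supp = {(1, (2, 0)), (1, (1, 0)), (1, (0, 1)), (1, (0, 0)), (0, (0, 1)), (0, (0, 0))}"

definition forward_coeff :: "'k::field \<Rightarrow> 'k \<Rightarrow> (nat \<Rightarrow> 'k) \<Rightarrow> nat \<Rightarrow> nat \<times> gam \<Rightarrow> 'k" where
  "forward_coeff F u D i = (\<lambda>(e, v).
     if e = 0 then (if v = (0, 1) then - F else F)
     else if v = (2, 0) then D i else if v = (1, 0) then - u - 2 * D i
     else if v = (0, 1) then - 1 else - D i - u - 1)"

definition symmetric_supp :: "(nat \<times> gam) set" where
  "symmetric_supp = {(1, (1, 0)), (1, (- 1, 0)), (1, (0, 0)), (0, (0, 1)), (0, (0, - 1))}"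

definition symmetric_coeff :: "'k::field \<Rightarrow> 'k \<Rightarrow> (nat \<Rightarrow> 'k) \<Rightarrow> nat \<Rightarrow> nat \<times> gam \<Rightarrow> 'k" where
  "symmetric_coeff F u D i = (\<lambda>(e, v).
     if e = 0 then (if v = (0, 1) then F else - F)
     else if v = (1, 0) then u - D i else if v = (- 1, 0) then - (u + D i) else 2 * D i)"

context
  fixes \<alpha>1 \<alpha>2 :: "'k::field_char_0 \<Rightarrow> 'k" and F u :: 'k and D :: "nat \<Rightarrow> 'k" and J :: "nat set"
  assumes idf: "inversive_difference_field \<alpha>1 \<alpha>2"
    and J: "finite J" "\<And>i. i \<in> J \<Longrightarrow> 1 \<le> i"
    and F: "F \<noteq> 0"
begin

text \<open>Here the term \<open>\<alpha>1\<^sup>2 y\<close> with index \<open>2 i - 1\<close> sticks out in two of the four directions; in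
  the other two the extreme terms are those of the indeterminate with index \<open>2 i\<close>.\<close>

lemma forward_scheme:
  assumes D: "\<And>i. i \<in> J \<Longrightarrow> D i \<noteq> 0"
  shows "difference_scheme \<alpha>1 \<alpha>2 J forward_supp (forward_coeff F u D)"
proof (unfold_locales, goal_cases)
  case (6 s t)
  have "(s = 1 \<and> (t = 1 \<or> t = - 1)) \<or> (s = - 1 \<and> t = 1) \<or> (s = - 1 \<and> t = - 1)" using 6 by auto
  then show ?case
  proof (elim disjE)
    assume "s = 1 \<and> (t = 1 \<or> t = - 1)"
    then show ?thesis using D
      by (intro exI[of _ "1::nat"] exI[of _ "(2, 0) :: gam"]) (auto simp: forward_supp_def forward_coeff_def)
  next
    assume "s = - 1 \<and> t = 1"
    then show ?thesis using F
      by (intro exI[of _ "0::nat"] exI[of _ "(0, 1) :: gam"]) (auto simp: forward_supp_def forward_coeff_def)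
  next
    assume "s = - 1 \<and> t = - 1"
    then show ?thesis using F
      by (intro exI[of _ "0::nat"] exI[of _ "(0, 0) :: gam"]) (auto simp: forward_supp_def forward_coeff_def)
  qed
qed (use idf J F in \<open>auto simp: forward_supp_def forward_coeff_def\<close>)

text \<open>In all four directions the unique extreme term is taken among \<open>\<alpha>2 y\<close> and \<open>\<alpha>2\<^sup>-\<^sup>1 y\<close> with
  index \<open>2 i\<close>. Their coefficients \<open>F\<close> and \<open>- F\<close> never vanish, whereas \<open>u - D i\<close> or \<open>u + D i\<close> might.\<close>

lemma symmetric_scheme:
  "difference_scheme \<alpha>1 \<alpha>2 J symmetric_supp (symmetric_coeff F u D)"
proof (unfold_locales, goal_cases)
  case (6 s t)
  then show ?case using F
    by (intro exI[of _ "0::nat"] exI[of _ "(0, t) :: gam"])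
      (auto simp: symmetric_supp_def symmetric_coeff_def)
qed (use idf J F in \<open>auto simp: symmetric_supp_def symmetric_coeff_def\<close>)

text \<open>The exponents \<open>0, \<alpha>1, \<alpha>1\<^sup>2\<close> confine \<open>\<gamma> \<alpha>1\<close> to the ball of radius \<open>r - 1\<close>, and the exponent
  \<open>\<alpha>2\<close> removes one of its edges, which has \<open>r\<close> points. Hence there are \<open>2 r\<^sup>2 - 3 r + 1\<close> relations
  among \<open>4 r\<^sup>2 + 4 r + 2\<close> indeterminates for each component.\<close>

lemma forward_dim:
  assumes D: "\<And>i. i \<in> J \<Longrightarrow> D i \<noteq> 0"
  shows "sigma_dim_poly \<alpha>1 \<alpha>2 (\<Union>i\<in>J. {2 * i - 1, 2 * i}) (forward_eq F u D ` J)
    (smult (of_nat (card J)) [:1, 7, 2:])"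
proof -
  interpret s: difference_scheme \<alpha>1 \<alpha>2 J forward_supp "forward_coeff F u D"
    using D by (rule forward_scheme)
  have eq: "s.scheme_eq i = forward_eq F u D i" for i
    unfolding s.scheme_eq_def by (simp add: forward_supp_def forward_coeff_def forward_eq_def Let_def cst_minus)
  have card: "int (card (s.inner r)) = 2 * r^2 - 3 * r + 1" if r: "1 \<le> r" for r
  proof -
    \<comment> \<open>the points of the ball of radius \<open>r - 1\<close> that a step by \<open>(- 1, 1)\<close> moves out of the ball of radius \<open>r\<close>\<close>
    define edge where "edge = (\<lambda>k. (k - (r - 1), k)) ` {0..r - 1}"
    have edge: "edge \<subseteq> Gam (r - 1)" by (auto simp: edge_def Gam_def ord_gam_def)
    have "s.inner r = (\<lambda>(i, j). (i - 1, j)) ` (Gam (r - 1) - edge)"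
    proof (intro equalityI subsetI)
      fix \<gamma> assume "\<gamma> \<in> s.inner r"
      then have "(fst \<gamma> + 1, snd \<gamma>) \<in> Gam (r - 1) - edge"
        unfolding s.inner_def by (auto simp: forward_supp_def Gam_def ord_gam_def edge_def) arith
      then show "\<gamma> \<in> (\<lambda>(i, j). (i - 1, j)) ` (Gam (r - 1) - edge)"
        by (rule rev_image_eqI) simp
    next
      fix \<gamma> assume "\<gamma> \<in> (\<lambda>(i, j). (i - 1, j)) ` (Gam (r - 1) - edge)"
      then obtain i j where ij: "\<gamma> = (i - 1, j)" "\<bar>i\<bar> + \<bar>j\<bar> \<le> r - 1" "(i, j) \<notin> edge"
        by (auto simp: Gam_def ord_gam_def)
      have "\<not> (0 \<le> j \<and> j \<le> r - 1 \<and> i = j - (r - 1))" using ij(3) by (auto simp: edge_def)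
      then show "\<gamma> \<in> s.inner r"
        using ij(1,2) unfolding s.inner_def by (auto simp: forward_supp_def Gam_def ord_gam_def)
    qed
    then have "card (s.inner r) = card (Gam (r - 1) - edge)"
      by (simp add: card_image inj_on_def split: prod.splits)
    also have "\<dots> = card (Gam (r - 1)) - card edge"
      using edge by (simp add: card_Diff_subset finite_subset)
    finally have "int (card (s.inner r)) = int (card (Gam (r - 1))) - int (card edge)"
      using card_mono[OF finite_Gam edge] by simp
    also have "card edge = nat r" unfolding edge_def by (subst card_image) (auto simp: inj_on_def)
    finally show ?thesis using r card_Gam[of "r - 1"] by (simp add: power2_eq_square algebra_simps)
  qed
  have "\<forall>\<^sub>F r in at_top. poly (smult (of_nat (card J)) [:1, 7, 2:] :: rat poly) (of_int r)
     = of_nat (card J) * (2 * of_nat (card (Gam r)) - of_nat (card (s.inner r)))"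
    using eventually_ge_at_top[of "1::int"]
  proof eventually_elim
    case (elim r)
    have cards: "(of_nat (card (Gam r)) :: rat) = of_int (2 * r^2 + 2 * r + 1)"
      "(of_nat (card (s.inner r)) :: rat) = of_int (2 * r^2 - 3 * r + 1)"
      using elim card_Gam[of r] card[of r] by (metis of_int_of_nat_eq order_trans zero_le_one)+
    show ?case unfolding cards by (simp add: algebra_simps power2_eq_square)
  qed
  from s.sigma_dim_poly_scheme[OF this] show ?thesis unfolding s.inds_def eq .
qed

text \<open>All neighbours of \<open>\<gamma>\<close> must lie in the ball of radius \<open>r\<close>, so \<open>\<gamma>\<close> ranges over the ball of radius
  \<open>r - 1\<close>, which gives \<open>2 r\<^sup>2 - 2 r + 1\<close> relations.\<close>

lemma symmetric_dim:
  "sigma_dim_poly \<alpha>1 \<alpha>2 (\<Union>i\<in>J. {2 * i - 1, 2 * i}) (symmetric_eq F u D ` J)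
    (smult (of_nat (card J)) [:1, 6, 2:])"
proof -
  interpret s: difference_scheme \<alpha>1 \<alpha>2 J symmetric_supp "symmetric_coeff F u D"
    by (rule symmetric_scheme)
  have eq: "s.scheme_eq i = symmetric_eq F u D i" for i
    unfolding s.scheme_eq_def
    using cst_minus[of "u + D i"] by (simp add: symmetric_supp_def symmetric_coeff_def symmetric_eq_def cst_minus)
  have inner: "s.inner r = Gam (r - 1)" for r
    unfolding s.inner_def by (auto simp: symmetric_supp_def Gam_def ord_gam_def) arith
  have "\<forall>\<^sub>F r in at_top. poly (smult (of_nat (card J)) [:1, 6, 2:] :: rat poly) (of_int r)
     = of_nat (card J) * (2 * of_nat (card (Gam r)) - of_nat (card (s.inner r)))"
    using eventually_ge_at_top[of "1::int"]
  proof eventually_elim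
    case (elim r)
    have cards: "(of_nat (card (Gam r)) :: rat) = of_int (2 * r^2 + 2 * r + 1)"
      "(of_nat (card (s.inner r)) :: rat) = of_int (2 * (r - 1)^2 + 2 * (r - 1) + 1)"
      using elim card_Gam[of r] card_Gam[of "r - 1"] inner[of r]
      by (metis of_int_of_nat_eq order_trans zero_le_one, metis of_int_of_nat_eq diff_ge_0_iff_ge)
    show ?case unfolding cards by (simp add: algebra_simps power2_eq_square)
  qed
  from s.sigma_dim_poly_scheme[OF this] show ?thesis unfolding s.inds_def eq .
qed

end

theorem mainTheorem6:
  fixes \<alpha>1 \<alpha>2 :: "'k::field_char_0 \<Rightarrow> 'k"
    and F u :: 'k and D :: "nat \<Rightarrow> 'k" and N :: nat
  assumes "inversive_difference_field \<alpha>1 \<alpha>2"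
    and "N \<ge> 1"
    and "\<alpha>1 u = u"
    and "\<And>i. i \<in> {1..N} \<Longrightarrow> \<alpha>1 (D i) = D i"
    and "F \<noteq> 0"
    and "\<And>i. i \<in> {1..N} \<Longrightarrow> D i \<noteq> 0"
  shows
    "(\<forall>i\<in>{1..N}. sigma_dim_poly \<alpha>1 \<alpha>2 {2 * i - 1, 2 * i} {forward_eq F u D i} [:1, 7, 2:]) \<and>
     sigma_dim_poly \<alpha>1 \<alpha>2 {1..2 * N} (forward_eq F u D ` {1..N}) (smult (of_nat N) [:1, 7, 2:]) \<and>
     (\<forall>i\<in>{1..N}. sigma_dim_poly \<alpha>1 \<alpha>2 {2 * i - 1, 2 * i} {symmetric_eq F u D i} [:1, 6, 2:]) \<and>
     sigma_dim_poly \<alpha>1 \<alpha>2 {1..2 * N} (symmetric_eq F u D ` {1..N}) (smult (of_nat N) [:1, 6, 2:]) \<and>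
     (\<forall>i\<in>{1..N}. higher_strength \<alpha>1 \<alpha>2 {2 * i - 1, 2 * i} {symmetric_eq F u D i} {forward_eq F u D i}) \<and>
     higher_strength \<alpha>1 \<alpha>2 {1..2 * N} (symmetric_eq F u D ` {1..N}) (forward_eq F u D ` {1..N}) \<and>
     Polynomial.degree ([:1, 7, 2:] - [:1, 6, 2:] :: rat poly) < Polynomial.degree ([:1, 7, 2:] :: rat poly)"
proof -
  have one: "sigma_dim_poly \<alpha>1 \<alpha>2 {2 * i - 1, 2 * i} {forward_eq F u D i} [:1, 7, 2:]"
    "sigma_dim_poly \<alpha>1 \<alpha>2 {2 * i - 1, 2 * i} {symmetric_eq F u D i} [:1, 6, 2:]"
    if "i \<in> {1..N}" for i
    using forward_dim[of \<alpha>1 \<alpha>2 "{i}" F D u] symmetric_dim[of \<alpha>1 \<alpha>2 "{i}" F u D] assms that by auto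
  have inds: "(\<Union>i\<in>{1..N}. {2 * i - 1, 2 * i}) = {1..2 * N}"
  proof (intro equalityI subsetI)
    fix k assume k: "k \<in> {1..2 * N}"
    then have "k = 2 * ((k + 1) div 2) - 1 \<or> k = 2 * ((k + 1) div 2)" "(k + 1) div 2 \<in> {1..N}"
      by auto
    then show "k \<in> (\<Union>i\<in>{1..N}. {2 * i - 1, 2 * i})" by blast
  qed auto
  have all: "sigma_dim_poly \<alpha>1 \<alpha>2 {1..2 * N} (forward_eq F u D ` {1..N}) (smult (of_nat N) [:1, 7, 2:])"
    "sigma_dim_poly \<alpha>1 \<alpha>2 {1..2 * N} (symmetric_eq F u D ` {1..N}) (smult (of_nat N) [:1, 6, 2:])"
    using forward_dim[of \<alpha>1 \<alpha>2 "{1..N}" F D u] symmetric_dim[of \<alpha>1 \<alpha>2 "{1..N}" F u D] assms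
    unfolding inds by auto
  have "poly [:1, 6, 2:] (rat_of_int r) < poly [:1, 7, 2:] (of_int r)" if "1 \<le> r" for r :: int
    using that by (simp add: algebra_simps)
  then have less: "\<forall>\<^sub>F r :: int in at_top. poly (smult c [:1, 6, 2:]) (rat_of_int r) < poly (smult c [:1, 7, 2:]) (of_int r)"
    if "0 < c" for c :: rat
    using that eventually_ge_at_top[of "1::int"]
    by (auto elim!: eventually_mono intro: mult_strict_left_mono simp only: poly_smult)
  have "\<forall>i\<in>{1..N}. higher_strength \<alpha>1 \<alpha>2 {2 * i - 1, 2 * i} {symmetric_eq F u D i} {forward_eq F u D i}"
    unfolding higher_strength_def
    by (intro ballI exI conjI, erule one(2), erule one(1), rule less[of 1, unfolded smult_1_left, OF zero_less_one])
  moreover have "higher_strength \<alpha>1 \<alpha>2 {1..2 * N} (symmetric_eq F u D ` {1..N}) (forward_eq F u D ` {1..N})"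
    unfolding higher_strength_def
    by (intro exI conjI, rule all(2), rule all(1), rule less) (use assms(2) in simp)
  moreover have "Polynomial.degree ([:1, 7, 2:] - [:1, 6, 2:] :: rat poly) < Polynomial.degree ([:1, 7, 2:] :: rat poly)"
    by simp
  ultimately show ?thesis using one all by blast
qed

end
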